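(* Let $K$ be a topological field and let $X$ be a vector space over $K$ with $\dim_K X\geq 2$. (i) If $|X|$ is finite, then the group ${\rm Aut}(\Sigma(X),\tau_K(X))$ is isomorphic to $(X\rtimes \Gamma L_h(X))\times\mathbb{Z}/2\mathbb{Z}$. (ii) If $|X|$ is infinite, then the group ${\rm Aut}(\Sigma(X),\tau_K(X))$ is isomorphic to $X\rtimes \Gamma L_h(X)$. Here the group operation of $X\rtimes\Gamma L_h(X)$ is $(x_1,\phi_1)\cdot(x_2,\phi_2)=(x_1+\phi_1(x_2),\phi_1\circ\phi_2)$.
   Context: A topological field is a field $K$ endowed with a Hausdorff topology such that addition, multiplication, and inversion on $K\setminus\{0\}$ are continuous. For a non-empty set $X$, $\Sigma(X)$ is the complete lattice of all topologies on $X$ (as families of open sets) ordered by inclusion, and ${\rm Aut}(\Sigma(X))$ is the group of lattice automorphisms of $\Sigma(X)$. A vector topology on a vector space $X$ over a topological field $K$ is a (not necessarily Hausdorff) topology on $X$ for which addition $X\times X\to X$ and scalar multiplication $K\times X\to X$ are continuous. $\tau_K(X)\subset\Sigma(X)$ is the set of all vector topologies on $X$. Vector spaces may be infinite-dimensional. ${\rm Aut}(\Sigma(X),\tau_K(X))=\{\Phi\in{\rm Aut}(\Sigma(X))\mid\Phi(\tau_K(X))=\tau_K(X)\}$, a subgroup of ${\rm Aut}(\Sigma(X))$. For a field isomorphism $\psi:K\to K$, a bijection $\phi:X\to X$ is $\psi$-semilinear if $\phi(x_1+x_2)=\phi(x_1)+\phi(x_2)$ and $\phi(\alpha x)=\psi(\alpha)\phi(x)$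 for all $x_1,x_2,x\in X$, $\alpha\in K$. $\Gamma L_h(X)$ is the group (under composition) of all bijections $\phi:X\to X$ that are $\psi$-semilinear for some field automorphism $\psi:K\to K$ that is also a homeomorphism. *)

theory Defs
  imports
    "HOL-Analysis.Analysis"
    "HOL-Algebra.Complete_Lattice"
    "HOL-Algebra.Bij"
    "HOL-Algebra.Elementary_Groups"
    "HOL-Library.Extended_Nat"
begin

text \<open>The axiom is \<^term>\<open>continuous_on (- {0}) inverse\<close> unfolded; the folded form is not
  available inside a class specification.\<close>

class topological_field =
  field + t2_space + topological_comm_monoid_add + topological_semigroup_mult +
  assumes tendsto_inverse_nonzero:
    "a \<in> - {0} \<Longrightarrow> filterlim inverse (nhds (inverse a)) (at a within (- {0}))"

lemma continuous_on_inverse_nonzero: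
  "continuous_on (- {0}) (inverse :: 'a::topological_field \<Rightarrow> 'a)"
  unfolding continuous_on_def using tendsto_inverse_nonzero by blast

instance topological_field \<subseteq> topological_ab_group_add
proof
  fix a :: 'a
  have "((\<lambda>x. - 1 * x) \<longlongrightarrow> - 1 * a) (nhds a)"
    by (intro tendsto_mult tendsto_const filterlim_ident)
  then show "(uminus \<longlongrightarrow> - a) (nhds a)"
    by simp
qed

text \<open>The dimension is extended to infinity because \<^const>\<open>vector_space.dim\<close> returns
  \<open>0\<close> on spaces that have no finite basis.\<close>

definition vdim :: "('k::field \<Rightarrow> 'v::ab_group_add \<Rightarrow> 'v) \<Rightarrow> enat" where
  "vdim smul =
     (if \<exists>B. finite B \<and> module.span smul B = UNIV
      then enat (vector_space.dim smul UNIV) else \<infinity>)"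

definition topology_lattice :: "'a topology gorder" where
  "topology_lattice =
     \<lparr>carrier = {T. topspace T = UNIV}, eq = (=),
      le = (\<lambda>S T. {U. openin S U} \<subseteq> {U. openin T U})\<rparr>"

definition lattice_automorphisms :: "('a, 'b) gorder_scheme \<Rightarrow> ('a \<Rightarrow> 'a) set" where
  "lattice_automorphisms L = {\<Phi> \<in> Bij (carrier L). join_pres L L \<Phi> \<and> meet_pres L L \<Phi>}"

definition vector_topologies ::
    "('k::topological_field \<Rightarrow> 'v::ab_group_add \<Rightarrow> 'v) \<Rightarrow> 'v topology set" where
  "vector_topologies smul =
     {T. topspace T = UNIV \<and>
         continuous_map (prod_topology T T) T (\<lambda>(x, y). x + y) \<and>
         continuous_map (prod_topology euclidean T) T (\<lambda>(\<alpha>, x). smul \<alpha> x)}"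

text \<open>A map on topologies is only relevant on those with underlying set \<^term>\<open>UNIV\<close>;
  membership in \<^const>\<open>Bij\<close> fixes it to be \<^const>\<open>undefined\<close> elsewhere, so that equality of
  functions is equality of automorphisms.\<close>

definition Aut_Sigma_tau ::
    "('k::topological_field \<Rightarrow> 'v::ab_group_add \<Rightarrow> 'v) \<Rightarrow> ('v topology \<Rightarrow> 'v topology) monoid" where
  "Aut_Sigma_tau smul =
     (BijGroup (carrier topology_lattice))
       \<lparr>carrier := {\<Phi> \<in> lattice_automorphisms topology_lattice.
                     \<Phi> ` vector_topologies smul = vector_topologies smul}\<rparr>"

definition field_automorphism :: "('k::field \<Rightarrow> 'k) \<Rightarrow> bool" where
  "field_automorphism \<psi> \<longleftrightarrow>
     bij \<psi> \<and> \<psi> 1 = 1 \<and> (\<forall>a b. \<psi> (a + b) = \<psi> a + \<psi> b) \<and> (\<forall>a b. \<psi> (a * b) = \<psi> a * \<psi> b)"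

definition semilinear ::
    "('k::field \<Rightarrow> 'v::ab_group_add \<Rightarrow> 'v) \<Rightarrow> ('k \<Rightarrow> 'k) \<Rightarrow> ('v \<Rightarrow> 'v) \<Rightarrow> bool" where
  "semilinear smul \<psi> \<phi> \<longleftrightarrow>
     (\<forall>x y. \<phi> (x + y) = \<phi> x + \<phi> y) \<and> (\<forall>\<alpha> x. \<phi> (smul \<alpha> x) = smul (\<psi> \<alpha>) (\<phi> x))"

definition GammaL_h :: "('k::topological_field \<Rightarrow> 'v::ab_group_add \<Rightarrow> 'v) \<Rightarrow> ('v \<Rightarrow> 'v) set" where
  "GammaL_h smul =
     {\<phi>. bij \<phi> \<and>
         (\<exists>\<psi>. field_automorphism \<psi> \<and> homeomorphic_map euclidean euclidean \<psi> \<and> semilinear smul \<psi> \<phi>)}"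

definition semidirect_GammaL_h ::
    "('k::topological_field \<Rightarrow> 'v::ab_group_add \<Rightarrow> 'v) \<Rightarrow> ('v \<times> ('v \<Rightarrow> 'v)) monoid" where
  "semidirect_GammaL_h smul =
     \<lparr>carrier = UNIV \<times> GammaL_h smul,
      mult = (\<lambda>(x1, \<phi>1) (x2, \<phi>2). (x1 + \<phi>1 x2, \<phi>1 \<circ> \<phi>2)),
      one = (0, id)\<rparr>"

text \<open>\<^const>\<open>join_pres\<close> and \<^const>\<open>meet_pres\<close> include the requirement that their
  arguments are lattices; the next result discharges it.\<close>

lemma openin_Inf_topologies:
  assumes "A \<noteq> {}"
  shows "openin (topology (\<lambda>U. \<forall>T\<in>A. openin T U)) U \<longleftrightarrow> (\<forall>T\<in>A. openin T U)"
proof -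
  have "istopology (\<lambda>U. \<forall>T\<in>A. openin T U)"
    by (auto simp: istopology_def)
  then show ?thesis by (simp add: topology_inverse')
qed

lemma complete_lattice_topology_lattice: "complete_lattice (topology_lattice :: 'a topology gorder)"
proof -
  let ?L = "topology_lattice :: 'a topology gorder"
  interpret partial_order ?L
    by standard (auto simp: topology_lattice_def topology_eq)
  show ?thesis
  proof (rule complete_lattice_criterion1)
    show "\<exists>g. greatest ?L g (carrier ?L)"
      by (rule exI[of _ "discrete_topology UNIV"]) (auto simp: greatest_def topology_lattice_def)
    fix A :: "'a topology set"
    assume A: "A \<subseteq> carrier ?L" "A \<noteq> {}"
    let ?I = "topology (\<lambda>U. \<forall>T\<in>A. openin T U)"
    have op: "openin ?I U \<longleftrightarrow> (\<forall>T\<in>A. openin T U)" for U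
      using openin_Inf_topologies[OF A(2)] .
    have "openin T UNIV" if "T \<in> A" for T
    proof -
      have "topspace T = UNIV"
        using A(1) that by (auto simp: topology_lattice_def)
      then show ?thesis using openin_topspace[of T] by simp
    qed
    then have "openin ?I UNIV" by (simp add: op)
    then have I: "topspace ?I = UNIV"
      using openin_subset by blast
    have "greatest ?L ?I (Lower ?L A)"
      unfolding greatest_def
    proof (intro conjI ballI)
      show "Lower ?L A \<subseteq> carrier ?L" by (auto simp: Lower_def)
      show "?I \<in> Lower ?L A" by (auto simp: Lower_def topology_lattice_def op I)
      fix S assume S: "S \<in> Lower ?L A"
      have "openin T U" if "T \<in> A" "openin S U" for T U
      proof -
        have "S \<sqsubseteq>\<^bsub>?L\<^esub> T" using S A(1) that(1) unfolding Lower_def by blast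
        then show ?thesis using that(2) by (auto simp: topology_lattice_def)
      qed
      then show "S \<sqsubseteq>\<^bsub>?L\<^esub> ?I" by (auto simp: topology_lattice_def op)
    qed
    then show "\<exists>i. greatest ?L i (Lower ?L A)" by blast
  qed
qed

lemma subgroup_lattice_automorphisms:
  assumes "lattice L"
  shows "subgroup (lattice_automorphisms L) (BijGroup (carrier L))"
proof -
  interpret lattice L by fact
  interpret G: group "BijGroup (carrier L)" by (rule group_BijGroup)
  show ?thesis
  proof (rule G.subgroupI)
    show "lattice_automorphisms L \<subseteq> carrier (BijGroup (carrier L))"
      by (auto simp: lattice_automorphisms_def BijGroup_def)
    have "restrict (\<lambda>x. x) (carrier L) \<in> lattice_automorphisms L"
      using assms by (auto simp: lattice_automorphisms_def id_Bij join_pres_def meet_pres_def)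
    then show "lattice_automorphisms L \<noteq> {}" by auto
  next
    fix f assume f: "f \<in> lattice_automorphisms L"
    then have fB: "f \<in> Bij (carrier L)" by (auto simp: lattice_automorphisms_def)
    then have bij: "bij_betw f (carrier L) (carrier L)" by (auto simp: Bij_def)
    let ?g = "restrict (inv_into (carrier L) f) (carrier L)"
    have gB: "?g \<in> Bij (carrier L)" using fB by (rule restrict_inv_into_Bij)
    have g: "?g x \<in> carrier L" "f (?g x) = x" if "x \<in> carrier L" for x
      using that bij by (auto simp: bij_betw_def f_inv_into_f inv_into_into)
    have gf: "?g (f x) = x" if "x \<in> carrier L" for x
      using that bij by (auto simp: bij_betw_def)
    have "?g (x \<squnion>\<^bsub>L\<^esub> y) = ?g x \<squnion>\<^bsub>L\<^esub> ?g y" if "x \<in> carrier L" "y \<in> carrier L" for x y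
    proof -
      have "f (?g x \<squnion>\<^bsub>L\<^esub> ?g y) = x \<squnion>\<^bsub>L\<^esub> y"
        using f g[OF that(1)] g[OF that(2)] by (simp add: lattice_automorphisms_def join_pres_def)
      then show ?thesis
        using gf[of "?g x \<squnion>\<^bsub>L\<^esub> ?g y"] g(1)[OF that(1)] g(1)[OF that(2)] join_closed by metis
    qed
    moreover have "?g (x \<sqinter>\<^bsub>L\<^esub> y) = ?g x \<sqinter>\<^bsub>L\<^esub> ?g y" if "x \<in> carrier L" "y \<in> carrier L" for x y
    proof -
      have "f (?g x \<sqinter>\<^bsub>L\<^esub> ?g y) = x \<sqinter>\<^bsub>L\<^esub> y"
        using f g[OF that(1)] g[OF that(2)] by (simp add: lattice_automorphisms_def meet_pres_def)
      then show ?thesis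
        using gf[of "?g x \<sqinter>\<^bsub>L\<^esub> ?g y"] g(1)[OF that(1)] g(1)[OF that(2)] meet_closed by metis
    qed
    ultimately have "?g \<in> lattice_automorphisms L"
      using gB assms unfolding lattice_automorphisms_def join_pres_def meet_pres_def by blast
    then show "inv\<^bsub>BijGroup (carrier L)\<^esub> f \<in> lattice_automorphisms L"
      using inv_BijGroup[OF fB] by simp
  next
    fix f g assume fg: "f \<in> lattice_automorphisms L" "g \<in> lattice_automorphisms L"
    then have B: "f \<in> Bij (carrier L)" "g \<in> Bij (carrier L)"
      by (auto simp: lattice_automorphisms_def)
    have mem: "g x \<in> carrier L" if "x \<in> carrier L" for x
      using Bij_imp_funcset[OF B(2)] that by auto
    have "compose (carrier L) f g \<in> lattice_automorphisms L"
      using fg mem compose_Bij[OF B]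
      by (auto simp: lattice_automorphisms_def join_pres_def meet_pres_def compose_def)
    then show "f \<otimes>\<^bsub>BijGroup (carrier L)\<^esub> g \<in> lattice_automorphisms L"
      using B by (simp add: BijGroup_def)
  qed
qed

lemma group_Aut_Sigma_tau:
  fixes smul :: "'k::topological_field \<Rightarrow> 'b::ab_group_add \<Rightarrow> 'b"
  shows "group (Aut_Sigma_tau smul)"
proof -
  let ?C = "carrier (topology_lattice :: 'b topology gorder)"
  let ?A = "lattice_automorphisms (topology_lattice :: 'b topology gorder)"
  let ?V = "vector_topologies smul"
  interpret G: group "BijGroup ?C" by (rule group_BijGroup)
  have S: "subgroup ?A (BijGroup ?C)"
    by (intro subgroup_lattice_automorphisms complete_lattice_lattice
        complete_lattice_topology_lattice)
  have V: "?V \<subseteq> ?C" by (auto simp: vector_topologies_def topology_lattice_def)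
  have AB: "\<Phi> \<in> Bij ?C" if "\<Phi> \<in> ?A" for \<Phi>
    using that by (auto simp: lattice_automorphisms_def)
  have "subgroup {\<Phi> \<in> ?A. \<Phi> ` ?V = ?V} (BijGroup ?C)"
  proof (rule G.subgroupI)
    show "{\<Phi> \<in> ?A. \<Phi> ` ?V = ?V} \<subseteq> carrier (BijGroup ?C)"
      using subgroup.subset[OF S] by auto
    have "restrict (\<lambda>x. x) ?C \<in> ?A"
      using subgroup.one_closed[OF S] by (simp add: BijGroup_def)
    moreover have "restrict (\<lambda>x. x) ?C ` ?V = ?V" using V by force
    ultimately show "{\<Phi> \<in> ?A. \<Phi> ` ?V = ?V} \<noteq> {}" by blast
  next
    fix f assume "f \<in> {\<Phi> \<in> ?A. \<Phi> ` ?V = ?V}"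
    then have f: "f \<in> ?A" "f ` ?V = ?V" by auto
    then have fB: "f \<in> Bij ?C" using AB by blast
    then have inj: "inj_on f ?C" by (auto simp: Bij_def bij_betw_def)
    have "inv_into ?C f ` (f ` ?V) = ?V"
      using inv_into_image_cancel[OF inj V] .
    then have "inv_into ?C f ` ?V = ?V" using f(2) by simp
    moreover have "restrict (inv_into ?C f) ?C ` ?V = inv_into ?C f ` ?V"
      using V by (intro image_cong) auto
    ultimately have "restrict (inv_into ?C f) ?C ` ?V = ?V" by simp
    then have "(inv\<^bsub>BijGroup ?C\<^esub> f) ` ?V = ?V"
      unfolding inv_BijGroup[OF fB] .
    then show "inv\<^bsub>BijGroup ?C\<^esub> f \<in> {\<Phi> \<in> ?A. \<Phi> ` ?V = ?V}"
      using subgroup.m_inv_closed[OF S f(1)] by blast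
  next
    fix f g assume "f \<in> {\<Phi> \<in> ?A. \<Phi> ` ?V = ?V}" "g \<in> {\<Phi> \<in> ?A. \<Phi> ` ?V = ?V}"
    then have fg: "f \<in> ?A" "f ` ?V = ?V" "g \<in> ?A" "g ` ?V = ?V" by auto
    have "compose ?C f g T = f (g T)" if "T \<in> ?V" for T
      using V that by (auto simp: compose_def)
    then have "compose ?C f g ` ?V = f ` (g ` ?V)"
      unfolding image_image by (intro image_cong) simp_all
    also have "\<dots> = ?V" by (simp only: fg)
    finally have "compose ?C f g ` ?V = ?V" .
    moreover have "f \<otimes>\<^bsub>BijGroup ?C\<^esub> g = compose ?C f g"
      using AB[OF fg(1)] AB[OF fg(3)] by (simp add: BijGroup_def)
    ultimately show "f \<otimes>\<^bsub>BijGroup ?C\<^esub> g \<in> {\<Phi> \<in> ?A. \<Phi> ` ?V = ?V}"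
      using subgroup.m_closed[OF S fg(1) fg(3)] by simp
  qed
  then show ?thesis
    unfolding Aut_Sigma_tau_def by (rule G.subgroup_imp_group)
qed

lemma id_mem_GammaL_h: "id \<in> GammaL_h smul"
  by (auto simp: GammaL_h_def field_automorphism_def semilinear_def
      intro!: exI[of _ id])

lemma comp_mem_GammaL_h:
  assumes "\<phi>1 \<in> GammaL_h smul" "\<phi>2 \<in> GammaL_h smul"
  shows "\<phi>1 \<circ> \<phi>2 \<in> GammaL_h smul"
proof -
  obtain \<psi>1 where 1: "field_automorphism \<psi>1" "homeomorphic_map euclidean euclidean \<psi>1"
      "semilinear smul \<psi>1 \<phi>1" "bij \<phi>1"
    using assms(1) by (auto simp: GammaL_h_def)
  obtain \<psi>2 where 2: "field_automorphism \<psi>2" "homeomorphic_map euclidean euclidean \<psi>2"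
      "semilinear smul \<psi>2 \<phi>2" "bij \<phi>2"
    using assms(2) by (auto simp: GammaL_h_def)
  have "homeomorphic_map euclidean euclidean (\<psi>1 \<circ> \<psi>2)"
    using homeomorphic_map_compose[OF 2(2) 1(2)] .
  moreover have "field_automorphism (\<psi>1 \<circ> \<psi>2)"
    using 1(1) 2(1) by (auto simp: field_automorphism_def bij_comp)
  moreover have "semilinear smul (\<psi>1 \<circ> \<psi>2) (\<phi>1 \<circ> \<phi>2)"
    using 1(3) 2(3) by (auto simp: semilinear_def)
  ultimately show ?thesis
    using 1(4) 2(4) by (auto simp: GammaL_h_def bij_comp)
qed

lemma inv_mem_GammaL_h:
  assumes "\<phi> \<in> GammaL_h smul"
  shows "inv_into UNIV \<phi> \<in> GammaL_h smul"
proof -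
  obtain \<psi> where \<psi>: "field_automorphism \<psi>" "homeomorphic_map euclidean euclidean \<psi>"
      "semilinear smul \<psi> \<phi>" and \<phi>: "bij \<phi>"
    using assms by (auto simp: GammaL_h_def)
  have b: "bij \<psi>" using \<psi>(1) by (simp add: field_automorphism_def)
  have c1: "\<psi> (inv_into UNIV \<psi> a) = a" for a using b by (simp add: bij_is_surj surj_f_inv_f)
  have e1: "inv_into UNIV \<psi> a = c" if "a = \<psi> c" for a c using b that by (simp add: bij_is_inj)
  have e2: "inv_into UNIV \<phi> x = y" if "x = \<phi> y" for x y using \<phi> that by (simp add: bij_is_inj)
  have c2: "\<phi> (inv_into UNIV \<phi> x) = x" for x using \<phi> by (simp add: bij_is_surj surj_f_inv_f)
  have "field_automorphism (inv_into UNIV \<psi>)"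
    using \<psi>(1) b by (auto simp: field_automorphism_def c1 bij_imp_bij_inv intro!: e1)
  moreover have "homeomorphic_map euclidean euclidean (inv_into UNIV \<psi>)"
  proof -
    obtain g where g: "homeomorphic_maps euclidean euclidean \<psi> g"
      using \<psi>(2) homeomorphic_map_maps by blast
    then have "\<psi> (g a) = a" for a by (simp add: homeomorphic_maps_def)
    then have "inv_into UNIV \<psi> = g" by (intro ext e1) simp
    moreover have "homeomorphic_map euclidean euclidean g"
      using g by (simp add: homeomorphic_maps_map)
    ultimately show ?thesis by simp
  qed
  moreover have "semilinear smul (inv_into UNIV \<psi>) (inv_into UNIV \<phi>)"
    using \<psi>(3) by (auto simp: semilinear_def c1 c2 intro!: e2)
  ultimately show ?thesis
    using \<phi> by (auto simp: GammaL_h_def bij_imp_bij_inv)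
qed

lemma group_semidirect_GammaL_h: "group (semidirect_GammaL_h smul)"
proof (rule groupI)
  have add: "\<phi> (x + y) = \<phi> x + \<phi> y" if "\<phi> \<in> GammaL_h smul" for \<phi> x y
    using that by (auto simp: GammaL_h_def semilinear_def)
  fix p assume "p \<in> carrier (semidirect_GammaL_h smul)"
  then obtain x \<phi> where p: "p = (x, \<phi>)" "\<phi> \<in> GammaL_h smul"
    by (auto simp: semidirect_GammaL_h_def)
  have b: "bij \<phi>" using p by (auto simp: GammaL_h_def)
  have i: "inv_into UNIV \<phi> \<in> GammaL_h smul" using p inv_mem_GammaL_h by blast
  have "inv_into UNIV \<phi> \<circ> \<phi> = id" using b by (simp add: bij_is_inj)
  then show "\<exists>q\<in>carrier (semidirect_GammaL_h smul).
      q \<otimes>\<^bsub>semidirect_GammaL_h smul\<^esub> p = \<one>\<^bsub>semidirect_GammaL_h smul\<^esub>"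
    using i p by (intro bexI[of _ "(- inv_into UNIV \<phi> x, inv_into UNIV \<phi>)"]) (auto simp: semidirect_GammaL_h_def)
  show "\<one>\<^bsub>semidirect_GammaL_h smul\<^esub> \<otimes>\<^bsub>semidirect_GammaL_h smul\<^esub> p = p"
    using p by (auto simp: semidirect_GammaL_h_def)
  fix q r assume "q \<in> carrier (semidirect_GammaL_h smul)" "r \<in> carrier (semidirect_GammaL_h smul)"
  then show "p \<otimes>\<^bsub>semidirect_GammaL_h smul\<^esub> q \<otimes>\<^bsub>semidirect_GammaL_h smul\<^esub> r =
      p \<otimes>\<^bsub>semidirect_GammaL_h smul\<^esub> (q \<otimes>\<^bsub>semidirect_GammaL_h smul\<^esub> r)"
    using p add by (auto simp: semidirect_GammaL_h_def add.assoc)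
next
  fix p q assume "p \<in> carrier (semidirect_GammaL_h smul)" "q \<in> carrier (semidirect_GammaL_h smul)"
  then show "p \<otimes>\<^bsub>semidirect_GammaL_h smul\<^esub> q \<in> carrier (semidirect_GammaL_h smul)"
    by (auto simp: semidirect_GammaL_h_def comp_mem_GammaL_h)
next
  show "\<one>\<^bsub>semidirect_GammaL_h smul\<^esub> \<in> carrier (semidirect_GammaL_h smul)"
    by (simp add: semidirect_GammaL_h_def id_mem_GammaL_h)
qed

end

theory Submission
  imports Defs
begin

text \<open>
  Two classical facts meet here: Hartmanis' description of the automorphisms of the lattice of
  topologies, and a fundamental theorem of affine geometry for maps that preserve parallelism.

  A lattice automorphism permutes the topologies \<open>{\<emptyset>, A, X}\<close>, so it acts on
  the subsets \<open>A\<close> of \<open>X\<close>, and this action \<open>F\<close> carries the open sets of each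
  topology to those of its image (\<open>lattice_automorphism_permutes_sets\<close>). Two sets
  \<open>A\<close> and \<open>B\<close> generate a topology with at most the further members
  \<open>A \<inter> B\<close> and \<open>A \<union> B\<close>; how many of these are new is invariant under
  \<open>F\<close>. As soon as \<open>X\<close> has four points, this count singles out the points and their
  complements among all sets, shows that \<open>F\<close> either maps points to points or maps points to
  complements of points, and recovers membership. So \<open>F\<close> is the image under a permutation
  of \<open>X\<close>, possibly followed by complementation. The second case is impossible when
  \<open>X\<close> is infinite, because there the cofinite topology, generated by the complements of
  points, differs from the discrete one, generated by the points
  (\<open>topological_permutation_cases\<close>).

  It remains to find the permutations \<open>f\<close> of \<open>X\<close> that preserve the set of vector
  topologies. Translations preserve every single vector topology, so let \<open>f 0 = 0\<close>. In a
  vector topology the points that cannot be separated from \<open>0\<close> by open sets form a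
  subspace, and inseparability in general is congruence modulo this subspace. For the initial
  topology of a linear functional the subspace is the kernel, hence \<open>f\<close> maps the cosets of
  every hyperplane to the cosets of a subspace, and, by intersecting hyperplanes, so it does for
  every subspace (\<open>image_subspace\<close>). The same holds for the inverse of \<open>f\<close>, whence
  \<open>f\<close> maps lines to lines and preserves parallelism. In dimension at least two this makes
  \<open>f\<close> semilinear (\<open>parallel_preserving_imp_semilinear\<close>). Working with parallel
  classes instead of mere collinearity covers the field of two elements as well. The accompanying
  field automorphism is a homeomorphism because scalar multiplication is continuous for the images
  under \<open>f\<close> and its inverse of the topologies of functionals
  (\<open>open_image_field_automorphism\<close>).

  Complementation, finally, contributes the factor of order two: on a finite space the open sets
  of a vector topology are closed, so that exchanging open and closed sets fixes every vector
  topology, and it commutes with all permutations of the points.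
\<close>

section \<open>Permutations of sets that preserve topologies\<close>

definition topological_family :: "'a set set \<Rightarrow> bool" where
  "topological_family \<T> \<longleftrightarrow> istopology (\<lambda>U. U \<in> \<T>) \<and> UNIV \<in> \<T>"

text \<open>The action on subsets that a lattice automorphism induces; the two directions of the
  equivalence make the notion invariant under inversion.\<close>

definition topological_permutation :: "('a set \<Rightarrow> 'a set) \<Rightarrow> bool" where
  "topological_permutation F \<longleftrightarrow>
     bij F \<and> (\<forall>\<T>. topological_family (F ` \<T>) \<longleftrightarrow> topological_family \<T>)"

lemma topological_family_empty: "topological_family \<T> \<Longrightarrow> {} \<in> \<T>"
  unfolding topological_family_def istopology_def
  by (elim conjE allE[of _ "{}"]) simp

lemma topological_family_Int: "topological_family \<T> \<Longrightarrow> A \<in> \<T> \<Longrightarrow> B \<in> \<T> \<Longrightarrow> A \<inter> B \<in> \<T>"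
  by (auto simp: topological_family_def istopology_def)

lemma topological_family_Union: "topological_family \<T> \<Longrightarrow> \<U> \<subseteq> \<T> \<Longrightarrow> \<Union>\<U> \<in> \<T>"
  unfolding topological_family_def istopology_def by blast

lemma topological_family_Un:
  assumes "topological_family \<T>" "A \<in> \<T>" "B \<in> \<T>"
  shows "A \<union> B \<in> \<T>"
  using topological_family_Union[OF assms(1), of "{A, B}"] assms by auto

lemma topological_family_finiteI:
  assumes "finite \<T>" "{} \<in> \<T>" "UNIV \<in> \<T>"
    and Int: "\<And>A B. A \<in> \<T> \<Longrightarrow> B \<in> \<T> \<Longrightarrow> A \<inter> B \<in> \<T>"
    and Un: "\<And>A B. A \<in> \<T> \<Longrightarrow> B \<in> \<T> \<Longrightarrow> A \<union> B \<in> \<T>"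
  shows "topological_family \<T>"
proof -
  have "\<Union>\<U> \<in> \<T>" if "\<U> \<subseteq> \<T>" for \<U>
    using finite_subset[OF that assms(1)] that
    by (induction rule: finite_induct) (auto simp: assms(2) Un)
  then show ?thesis
    unfolding topological_family_def istopology_def using assms(3) Int by (simp add: subset_iff)
qed

text \<open>The topology generated by two sets.\<close>

definition pair_topology :: "'a set \<Rightarrow> 'a set \<Rightarrow> 'a set set" where
  "pair_topology A B = {{}, UNIV, A, B, A \<inter> B, A \<union> B}"

lemma topological_family_pair: "topological_family (pair_topology A B)"
  unfolding pair_topology_def
  by (rule topological_family_finiteI; (elim insertE emptyE)?) (simp_all add: Int_ac Un_ac)

lemma pair_topology_least:
  "topological_family \<T> \<Longrightarrow> A \<in> \<T> \<Longrightarrow> B \<in> \<T> \<Longrightarrow> pair_topology A B \<subseteq> \<T>"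
  by (simp add: pair_topology_def topological_family_empty topological_family_Int
      topological_family_Un) (simp add: topological_family_def)

text \<open>Counting new members of the generated topology is invariant under lattice automorphisms; this is
  the case of count zero, and it alone suffices to recover membership of points.\<close>

definition unmixed :: "'a set \<Rightarrow> 'a set \<Rightarrow> bool" where
  "unmixed A B \<longleftrightarrow> pair_topology A B \<subseteq> {{}, UNIV, A, B}"

text \<open>Joining any further set with \<open>A\<close> creates at most one new set. This will turn out
  to characterise the points and their complements.\<close>

definition extremal :: "'a set \<Rightarrow> bool" where
  "extremal A \<longleftrightarrow> A \<noteq> {} \<and> A \<noteq> UNIV \<and>
     (\<forall>B. \<exists>C. pair_topology A B \<subseteq> {{}, UNIV, A, B, C})"

lemma unmixed_iff: "unmixed A B \<longleftrightarrow> A \<subseteq> B \<or> B \<subseteq> A \<or> B = - A"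
proof
  assume "unmixed A B"
  then have "A \<inter> B \<in> {{}, UNIV, A, B}" "A \<union> B \<in> {{}, UNIV, A, B}"
    by (simp_all add: unmixed_def pair_topology_def)
  then show "A \<subseteq> B \<or> B \<subseteq> A \<or> B = - A" by blast
next
  assume "A \<subseteq> B \<or> B \<subseteq> A \<or> B = - A"
  then have "A \<inter> B \<in> {{}, UNIV, A, B} \<and> A \<union> B \<in> {{}, UNIV, A, B}"
    by (elim disjE) (simp_all add: Int_absorb1 Int_absorb2 Un_absorb1 Un_absorb2)
  then show "unmixed A B" by (simp add: unmixed_def pair_topology_def)
qed

lemma extremal_singleton:
  assumes "\<exists>y. y \<noteq> x"
  shows "extremal {x}"
proof -
  have "\<exists>C. pair_topology {x} B \<subseteq> {{}, UNIV, {x}, B, C}" for B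
    by (rule exI[of _ "insert x B"], cases "x \<in> B") (simp_all add: pair_topology_def)
  moreover have "{x} \<noteq> UNIV" using assms by blast
  ultimately show ?thesis by (simp add: extremal_def)
qed

lemma extremal_cosingleton:
  assumes "\<exists>y. y \<noteq> x"
  shows "extremal (- {x})"
proof -
  have "\<exists>C. pair_topology (- {x}) B \<subseteq> {{}, UNIV, - {x}, B, C}" for B
  proof -
    have "- {x} \<inter> B = B - {x}" "- {x} \<union> B \<in> {UNIV, - {x}}" by blast+
    then show ?thesis by (intro exI[of _ "B - {x}"]) (simp add: pair_topology_def, blast)
  qed
  moreover have "- {x} \<noteq> {}" "- {x} \<noteq> UNIV" using assms by blast+
  ultimately show ?thesis by (simp add: extremal_def)
qed

text \<open>If \<open>A\<close> has two points \<open>a\<close>, \<open>a'\<close> and misses two points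
  \<open>c\<close>, \<open>c'\<close>, then \<open>{a, c}\<close> creates two new sets,
  \<open>{a}\<close> and \<open>A \<union> {c}\<close>.\<close>

lemma extremal_cases:
  assumes "extremal A"
  obtains x where "A = {x}" | x where "A = - {x}"
proof -
  have "\<exists>x. A = {x} \<or> A = - {x}"
  proof (rule ccontr)
    assume *: "\<nexists>x. A = {x} \<or> A = - {x}"
    obtain a where a: "a \<in> A" using assms by (auto simp: extremal_def)
    obtain a' where a': "a' \<in> A" "a' \<noteq> a" using * a by blast
    obtain c where c: "c \<notin> A" using assms by (auto simp: extremal_def)
    obtain c' where c': "c' \<notin> A" "c' \<noteq> c" using * c by blast
    obtain C where "pair_topology A {a, c} \<subseteq> {{}, UNIV, A, {a, c}, C}"
      using assms unfolding extremal_def by blast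
    moreover have "A \<inter> {a, c} = {a}" "A \<union> {a, c} = insert c A" using a c by auto
    ultimately have "{a} \<in> {{}, UNIV, A, {a, c}, C}" "insert c A \<in> {{}, UNIV, A, {a, c}, C}"
      unfolding pair_topology_def by auto
    moreover have "{a} \<noteq> UNIV" "{a} \<noteq> A" "{a} \<noteq> {a, c}" using a a' c by auto
    moreover have "insert c A \<noteq> UNIV" using c' by blast
    moreover have "insert c A \<noteq> A" "insert c A \<noteq> {a, c}" using a a' c by blast+
    ultimately have "C = {a}" "C = insert c A" by auto
    then show False using c a by blast
  qed
  then show ?thesis using that by blast
qed

lemma topological_permutation_inv:
  assumes "topological_permutation F"
  shows "topological_permutation (inv_into UNIV F)"
proof -
  have b: "bij F" using assms by (simp add: topological_permutation_def)
  have e: "F ` inv_into UNIV F ` \<T> = \<T>" for \<T>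
    using b by (simp add: image_f_inv_f bij_is_surj)
  have *: "topological_family (F ` \<T>) \<longleftrightarrow> topological_family \<T>" for \<T>
    using assms by (simp add: topological_permutation_def)
  have "topological_family (inv_into UNIV F ` \<T>) \<longleftrightarrow> topological_family \<T>" for \<T>
    using *[of "inv_into UNIV F ` \<T>"] unfolding e by (rule sym)
  then show ?thesis
    using bij_imp_bij_inv[OF b] by (simp add: topological_permutation_def)
qed

context
  fixes F :: "'a set \<Rightarrow> 'a set"
  assumes F: "topological_permutation F"
begin

lemma inj_F: "inj F" and surj_F: "surj F"
  using F by (auto simp: topological_permutation_def bij_def)

text \<open>Being the least topology that contains two given sets is preserved in both directions.\<close>

lemma image_pair_topology: "F ` pair_topology A B = pair_topology (F A) (F B)"
proof
  show "pair_topology (F A) (F B) \<subseteq> F ` pair_topology A B"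
  proof (rule pair_topology_least)
    show "topological_family (F ` pair_topology A B)"
      using F by (simp add: topological_permutation_def topological_family_pair)
  qed (simp_all add: pair_topology_def)
  have "pair_topology A B \<subseteq> inv_into UNIV F ` pair_topology (F A) (F B)"
  proof (rule pair_topology_least)
    show "topological_family (inv_into UNIV F ` pair_topology (F A) (F B))"
      using topological_permutation_inv[OF F] topological_family_pair
      by (auto simp: topological_permutation_def)
    have "inv_into UNIV F (F A) = A" "inv_into UNIV F (F B) = B" using inj_F by simp_all
    then show "A \<in> inv_into UNIV F ` pair_topology (F A) (F B)" "B \<in> inv_into UNIV F ` pair_topology (F A) (F B)"
      unfolding pair_topology_def by (metis image_eqI insertCI)+
  qed
  then have "F ` pair_topology A B \<subseteq> F ` inv_into UNIV F ` pair_topology (F A) (F B)"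
    by (rule image_mono)
  then show "F ` pair_topology A B \<subseteq> pair_topology (F A) (F B)"
    using surj_F by (simp add: image_f_inv_f)
qed

text \<open>Every topology contains these two sets, so the image of the indiscrete topology has no room
  for others. The map may still exchange them.\<close>

lemma image_trivial: "F ` {{}, UNIV} = {{}, UNIV}"
proof -
  have "pair_topology {} UNIV = {{}, UNIV :: 'a set}"
    by (simp add: pair_topology_def insert_commute)
  then have "pair_topology (F {}) (F UNIV) = {F {}, F UNIV}"
    using image_pair_topology[of "{}" UNIV] by simp
  moreover have "{{}, UNIV} \<subseteq> pair_topology (F {}) (F UNIV)"
    by (auto simp: pair_topology_def)
  moreover have "({} :: 'a set) \<noteq> UNIV" by auto
  ultimately show ?thesis by auto
qed

lemma proper_image: "F A \<in> {{}, UNIV} \<longleftrightarrow> A \<in> {{}, UNIV}"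
  using inj_image_mem_iff[OF inj_F, of A "{{}, UNIV}"] unfolding image_trivial .

lemma image_insert_trivial: "F ` ({{}, UNIV} \<union> \<A>) = {{}, UNIV} \<union> F ` \<A>"
  by (simp only: image_Un image_trivial)

lemma unmixed_image: "unmixed (F A) (F B) \<longleftrightarrow> unmixed A B"
proof -
  have "F ` {{}, UNIV, A, B} = {{}, UNIV, F A, F B}"
    using image_insert_trivial[of "{A, B}"]
    by (simp only: image_insert image_empty Un_insert_left Un_empty_left)
  then show ?thesis
    unfolding unmixed_def image_pair_topology[symmetric]
    using inj_image_subset_iff[OF inj_F] by metis
qed

lemma extremal_image: "extremal (F A) \<longleftrightarrow> extremal A"
proof -
  have "(\<forall>B. \<exists>C. pair_topology (F A) B \<subseteq> {{}, UNIV, F A, B, C}) \<longleftrightarrow>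
      (\<forall>B. \<exists>C. pair_topology (F A) (F B) \<subseteq> {{}, UNIV, F A, F B, F C})"
    using surj_F by (metis surjD)
  moreover have "{{}, UNIV, F A, F B, F C} = F ` {{}, UNIV, A, B, C}" for B C
    using image_insert_trivial[of "{A, B, C}"]
    by (simp only: image_insert image_empty Un_insert_left Un_empty_left)
  ultimately have "(\<forall>B. \<exists>C. pair_topology (F A) B \<subseteq> {{}, UNIV, F A, B, C}) \<longleftrightarrow>
      (\<forall>B. \<exists>C. pair_topology A B \<subseteq> {{}, UNIV, A, B, C})"
    by (simp only: image_pair_topology[symmetric] inj_image_subset_iff[OF inj_F])
  moreover have "F A \<noteq> {} \<and> F A \<noteq> UNIV \<longleftrightarrow> A \<noteq> {} \<and> A \<noteq> UNIV"
    using proper_image[of A] by (simp, blast)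
  ultimately show ?thesis unfolding extremal_def by (simp only: conj_assoc[symmetric])
qed

end

text \<open>Two distinct points generate a new set, and so do two distinct complements of points, whereas a
  point and the complement of a point never do. Hence the images of all points are of one kind.\<close>

lemma singletons_same_kind:
  fixes F :: "'a set \<Rightarrow> 'a set"
  assumes F: "topological_permutation F"
    and big: "\<And>a b c :: 'a. \<exists>d. d \<noteq> a \<and> d \<noteq> b \<and> d \<noteq> c"
  obtains f where "\<And>x. F {x} = {f x}" | f where "\<And>x. F {x} = - {f x}"
proof -
  have ex: "extremal (F {x})" for x
    using big[of x] extremal_image[OF F] extremal_singleton by metis
  have nn: "\<not> unmixed (F {x}) (F {y})" if "x \<noteq> y" for x y
  proof -
    have "{y} \<noteq> - {x}" using big[of x y] by blast
    then have "\<not> unmixed {x} {y}" using that by (simp add: unmixed_iff)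
    then show ?thesis by (simp add: unmixed_image[OF F])
  qed
  show ?thesis
  proof (cases "\<exists>x y. F {x} = {y}")
    case True
    then obtain x y where xy: "F {x} = {y}" by blast
    have "\<exists>z. F {u} = {z}" for u
    proof (cases "u = x")
      case False
      show ?thesis
        using ex[of u]
      proof (cases rule: extremal_cases)
        case (2 z)
        then have "unmixed (F {x}) (F {u})" unfolding xy unmixed_iff by auto
        then show ?thesis using nn[of x u] False by simp
      qed blast
    qed (use xy in blast)
    then show ?thesis using that(1) by metis
  next
    case False
    have "\<exists>z. F {u} = - {z}" for u
      using ex[of u] by (cases rule: extremal_cases) (use False in blast)+
    then show ?thesis using that(2) by metis
  qed
qed

text \<open>For a set \<open>A\<close> that is not extremal, \<open>x \<in> A\<close> holds exactly when
  \<open>{x}\<close> and \<open>A\<close> generate no new set, and this determines \<open>F A\<close>. The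
  complements of points escape this criterion; they are recognised afterwards by the two-element
  sets that they contain.\<close>

lemma topological_permutation_of_singletons:
  fixes F :: "'a set \<Rightarrow> 'a set"
  assumes F: "topological_permutation F"
    and big: "\<And>a b c :: 'a. \<exists>d. d \<noteq> a \<and> d \<noteq> b \<and> d \<noteq> c"
    and f: "\<And>x. F {x} = {f x}"
  shows "bij f" and "\<And>A. A \<noteq> {} \<Longrightarrow> A \<noteq> UNIV \<Longrightarrow> F A = f ` A"
proof -
  have inj: "inj F" using inj_F[OF F] .
  show bij: "bij f"
  proof (rule bijI)
    show "inj f" using inj f by (metis injD injI singleton_inject)
    have "\<exists>x. y = f x" for y
    proof -
      obtain g where g: "\<And>x. inv_into UNIV F {x} = {g x}"
        using singletons_same_kind[OF topological_permutation_inv[OF F] big]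
      proof cases
        case (2 g)
        have "{x} = - {g (f x)}" for x
          using 2[of "f x"] inj by (metis f inv_f_f)
        then show ?thesis using big by (metis ComplI singletonD)
      qed blast
      have "{y} = F (inv_into UNIV F {y})" using surj_F[OF F] by (simp add: surj_f_inv_f)
      then show ?thesis by (auto simp: g f)
    qed
    then show "surj f" by auto
  qed
  have ne: "\<not> extremal A \<Longrightarrow> A \<noteq> {} \<Longrightarrow> A \<noteq> UNIV \<Longrightarrow> F A = f ` A" for A
  proof -
    assume A: "\<not> extremal A" "A \<noteq> {}" "A \<noteq> UNIV"
    have sg: "unmixed {x} B \<longleftrightarrow> x \<in> B" if B: "\<not> extremal B" "B \<noteq> {}" for x :: 'a and B
    proof -
      have "\<exists>y. y \<noteq> x" using big[of x] by blast
      then have "extremal {x}" "extremal (- {x})"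
        by (rule extremal_singleton, rule extremal_cosingleton)
      then have "B \<noteq> - {x}" "B \<noteq> {x}" using B by auto
      then show ?thesis using B by (simp add: unmixed_iff subset_singleton_iff)
    qed
    have FA: "\<not> extremal (F A)" "F A \<noteq> {}"
      using A extremal_image[OF F] proper_image[OF F, of A] by auto
    have *: "f x \<in> F A \<longleftrightarrow> x \<in> A" for x
      using unmixed_image[OF F, of "{x}" A] sg[OF A(1,2), of x] sg[OF FA, of "f x"] by (simp add: f)
    show "F A = f ` A"
    proof (rule Set.set_eqI)
      fix y
      obtain x where "y = f x" using bij by (meson bij_pointE)
      then show "y \<in> F A \<longleftrightarrow> y \<in> f ` A"
        using * inj_image_mem_iff[OF bij_is_inj[OF bij]] by simp
    qed
  qed
  fix A :: "'a set" assume A: "A \<noteq> {}" "A \<noteq> UNIV"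
  show "F A = f ` A"
  proof (cases "extremal A")
    case True
    then show ?thesis
    proof (cases rule: extremal_cases)
      case (2 z)
      have "extremal (F A)" using True extremal_image[OF F] by blast
      then obtain w where w: "F A = - {w}"
      proof (cases rule: extremal_cases)
        case (1 y)
        then have "F A = F {inv_into UNIV f y}" using f bij by (simp add: bij_is_surj surj_f_inv_f)
        then have "A = {inv_into UNIV f y}" using inj by (auto dest: injD)
        then show ?thesis using 2 big[of z "inv_into UNIV f y"] by blast
      qed blast
      define u where "u = inv_into UNIV f w"
      have fu: "f u = w" using bij by (simp add: u_def bij_is_surj surj_f_inv_f)
      have "u = z"
      proof (rule ccontr)
        assume uz: "u \<noteq> z"
        obtain v where v: "v \<noteq> u" "v \<noteq> z" using big by blast
        obtain t where t: "t \<noteq> u" "t \<noteq> z" "t \<noteq> v" using big by blast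
        have B: "\<not> extremal {u, v}"
        proof
          assume "extremal {u, v}"
          then show False
          proof (cases rule: extremal_cases)
            case (1 x) then show ?thesis using v by auto
          next
            case (2 x)
            have "t \<notin> {u, v}" "z \<notin> {u, v}" using uz v t by auto
            then show ?thesis using t unfolding 2 by simp
          qed
        qed
        have "{u, v} \<noteq> UNIV" using t by blast
        then have FB: "F {u, v} = {w, f v}" using ne[OF B] fu by simp
        \<comment> \<open>\<open>{u, v}\<close> lies in \<open>- {z}\<close>, but its image contains \<open>w\<close> without covering \<open>- {w}\<close>.\<close>
        have "unmixed {u, v} A" unfolding 2 unmixed_iff using uz v by auto
        then have "unmixed {w, f v} (- {w})" using unmixed_image[OF F, of "{u, v}" A] FB w by simp
        moreover have fv: "f v \<noteq> w" using bij v fu by (metis bij_is_inj injD)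
        moreover have "f t \<noteq> w" "f t \<noteq> f v" using bij t fu by (metis bij_is_inj injD)+
        moreover have "{w, f v} \<noteq> - {w}" "\<not> {w, f v} \<subseteq> - {w}" by auto
        moreover have "f t \<in> - {w}" "f t \<notin> {w, f v}"
          using \<open>f t \<noteq> w\<close> \<open>f t \<noteq> f v\<close> by auto
        ultimately show False unfolding unmixed_iff by blast
      qed
      then show ?thesis using w 2 fu by (simp add: bij_image_Compl_eq[OF bij])
    qed (use f in auto)
  qed (use ne A in blast)
qed

lemma topological_family_uminus:
  assumes fin: "finite (UNIV :: 'a set)" and T: "topological_family (\<T> :: 'a set set)"
  shows "topological_family (uminus ` \<T>)"
proof (rule topological_family_finiteI)
  show "finite (uminus ` \<T>)" using fin by (simp add: Finite_Set.finite_set finite_subset[OF subset_UNIV])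
  show "{} \<in> uminus ` \<T>" using T by (auto simp: topological_family_def intro!: image_eqI[of _ _ UNIV])
  show "UNIV \<in> uminus ` \<T>" using topological_family_empty[OF T] by (auto intro!: image_eqI[of _ _ "{}"])
  show "A \<inter> B \<in> uminus ` \<T>" "A \<union> B \<in> uminus ` \<T>"
    if "A \<in> uminus ` \<T>" "B \<in> uminus ` \<T>" for A B
  proof -
    obtain A' B' where *: "A = - A'" "B = - B'" "A' \<in> \<T>" "B' \<in> \<T>" using \<open>A \<in> _\<close> \<open>B \<in> _\<close> by blast
    show "A \<inter> B \<in> uminus ` \<T>" "A \<union> B \<in> uminus ` \<T>"
      using topological_family_Un[OF T *(3,4)] topological_family_Int[OF T *(3,4)]
      unfolding *(1,2) by (metis Compl_Un Compl_Int imageI)+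
  qed
qed

lemma topological_permutation_uminus:
  assumes fin: "finite (UNIV :: 'a set)" and F: "topological_permutation (F :: 'a set \<Rightarrow> 'a set)"
  shows "topological_permutation (\<lambda>A. - F A)"
proof -
  have *: "topological_family (uminus ` \<T>) \<longleftrightarrow> topological_family \<T>" for \<T> :: "'a set set"
    using topological_family_uminus[OF fin, of \<T>] topological_family_uminus[OF fin, of "uminus ` \<T>"]
    by (auto simp: image_image)
  have "bij (uminus :: 'a set \<Rightarrow> 'a set)"
    by (rule involuntory_imp_bij) simp
  then have "bij (uminus \<circ> F)" using F unfolding topological_permutation_def by (blast intro: bij_comp)
  moreover have "(\<lambda>A. - F A) ` \<T> = uminus ` F ` \<T>" for \<T> by (simp add: image_image)
  ultimately show ?thesis
    using F * unfolding topological_permutation_def comp_def by metis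
qed

text \<open>The inverse of \<open>F\<close> has to exchange points and complements of points too. So the
  image of the cofinite topology contains all points and is discrete, which makes every set
  empty or cofinite.\<close>

lemma finite_of_singletons_to_cosingletons:
  fixes F :: "'a set \<Rightarrow> 'a set"
  assumes F: "topological_permutation F"
    and big: "\<And>a b c :: 'a. \<exists>d. d \<noteq> a \<and> d \<noteq> b \<and> d \<noteq> c"
    and f: "\<And>x. F {x} = - {f x}"
  shows "finite (UNIV :: 'a set)"
proof -
  \<comment> \<open>the cofinite topology\<close>
  define \<C> where "\<C> = {A :: 'a set. A = {} \<or> finite (- A)}"
  have C: "topological_family \<C>"
  proof -
    have "\<Union>\<U> \<in> \<C>" if "\<U> \<subseteq> \<C>" for \<U>
    proof (cases "\<Union>\<U> = {}")
      case False
      then obtain A where "A \<in> \<U>" "A \<noteq> {}" by auto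
      then have "finite (- A)" "- \<Union>\<U> \<subseteq> - A" using that by (auto simp: \<C>_def)
      then show ?thesis unfolding \<C>_def using finite_subset by blast
    qed (simp add: \<C>_def)
    then show ?thesis
      unfolding topological_family_def istopology_def by (auto simp: subset_iff) (auto simp: \<C>_def)
  qed
  have "{y} \<in> F ` \<C>" for y
    using singletons_same_kind[OF topological_permutation_inv[OF F] big]
  proof cases
    case (1 g)
    have "{y} = F (inv_into UNIV F {y})" using surj_F[OF F] by (simp add: surj_f_inv_f)
    then have "{y} = - {f (g y)}" by (simp add: 1 f)
    then show ?thesis using big[of y "f (g y)"] by blast
  next
    case (2 g)
    have "{y} = F (inv_into UNIV F {y})" using surj_F[OF F] by (simp add: surj_f_inv_f)
    moreover have "inv_into UNIV F {y} \<in> \<C>" by (simp add: 2 \<C>_def)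
    ultimately show ?thesis by blast
  qed
  then have "\<Union>((\<lambda>y. {y}) ` A) \<in> F ` \<C>" for A
    using F C by (intro topological_family_Union) (auto simp: topological_permutation_def)
  then have "F A \<in> F ` \<C>" for A by simp
  then have "A \<in> \<C>" for A using inj_image_mem_iff[OF inj_F[OF F]] by blast
  then have "{undefined :: 'a} \<in> \<C>" .
  then have "finite (- {undefined :: 'a} \<union> {undefined})" by (simp add: \<C>_def)
  then show ?thesis by (simp add: Un_commute)
qed

theorem topological_permutation_cases:
  fixes F :: "'a set \<Rightarrow> 'a set"
  assumes F: "topological_permutation F"
    and big: "\<And>a b c :: 'a. \<exists>d. d \<noteq> a \<and> d \<noteq> b \<and> d \<noteq> c"
  obtains f where "bij f" "\<And>A. A \<noteq> {} \<Longrightarrow> A \<noteq> UNIV \<Longrightarrow> F A = f ` A"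
  | f where "finite (UNIV :: 'a set)" "bij f" "\<And>A. A \<noteq> {} \<Longrightarrow> A \<noteq> UNIV \<Longrightarrow> F A = - f ` A"
  using singletons_same_kind[OF F big]
proof cases
  case (1 f)
  show ?thesis
    using topological_permutation_of_singletons[OF F big 1] that(1) by blast
next
  case (2 f)
  have fin: "finite (UNIV :: 'a set)"
    using finite_of_singletons_to_cosingletons[OF F big 2] .
  have "- F {x} = {f x}" for x by (simp add: 2)
  note * = topological_permutation_of_singletons[OF topological_permutation_uminus[OF fin F] big this]
  have "F A = - f ` A" if "A \<noteq> {}" "A \<noteq> UNIV" for A
    using *(2)[OF that] by (metis double_complement)
  then show ?thesis using that(2)[OF fin *(1)] by blast
qed

section \<open>Automorphisms of the lattice of topologies\<close>

text \<open>Joins and meets are determined by the order, and the order by joins; for bijections, preserving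
  the operations is the same as preserving the order in both directions.\<close>

lemma lattice_automorphisms_eq:
  assumes "lattice L"
  shows "lattice_automorphisms L =
    {\<Phi> \<in> Bij (carrier L). \<forall>x\<in>carrier L. \<forall>y\<in>carrier L. \<Phi> x \<sqsubseteq>\<^bsub>L\<^esub> \<Phi> y \<longleftrightarrow> x \<sqsubseteq>\<^bsub>L\<^esub> y}"
proof -
  interpret lattice L by fact
  have "\<Phi> x \<sqsubseteq>\<^bsub>L\<^esub> \<Phi> y \<longleftrightarrow> x \<sqsubseteq>\<^bsub>L\<^esub> y"
    if \<Phi>: "\<Phi> \<in> Bij (carrier L)" "join_pres L L \<Phi>" and xy: "x \<in> carrier L" "y \<in> carrier L" for \<Phi> x y
  proof -
    have "inj_on \<Phi> (carrier L)" and im: "\<Phi> x \<in> carrier L" "\<Phi> y \<in> carrier L"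
      using \<Phi>(1) xy Bij_imp_funcset[OF \<Phi>(1)] by (auto simp: Bij_def bij_betw_def)
    then have "\<Phi> (x \<squnion>\<^bsub>L\<^esub> y) = \<Phi> y \<longleftrightarrow> x \<squnion>\<^bsub>L\<^esub> y = y"
      using xy by (simp add: inj_on_eq_iff)
    then show ?thesis
      using \<Phi>(2) xy im by (simp add: join_pres_def le_iff_meet)
  qed
  moreover have "\<Phi> (x \<squnion>\<^bsub>L\<^esub> y) = \<Phi> x \<squnion>\<^bsub>L\<^esub> \<Phi> y \<and> \<Phi> (x \<sqinter>\<^bsub>L\<^esub> y) = \<Phi> x \<sqinter>\<^bsub>L\<^esub> \<Phi> y"
    if \<Phi>: "\<Phi> \<in> Bij (carrier L)"
      and ord: "\<forall>x\<in>carrier L. \<forall>y\<in>carrier L. \<Phi> x \<sqsubseteq>\<^bsub>L\<^esub> \<Phi> y \<longleftrightarrow> x \<sqsubseteq>\<^bsub>L\<^esub> y"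
      and xy: "x \<in> carrier L" "y \<in> carrier L" for \<Phi> x y
  proof
    have im: "\<Phi> z \<in> carrier L" if "z \<in> carrier L" for z
      using that Bij_imp_funcset[OF \<Phi>] by auto
    have sj: "\<exists>z\<in>carrier L. w = \<Phi> z" if "w \<in> carrier L" for w
      using that \<Phi> by (auto simp: Bij_def bij_betw_def)
    note c = xy im[OF xy(1)] im[OF xy(2)]
    obtain z where z: "z \<in> carrier L" "\<Phi> x \<squnion>\<^bsub>L\<^esub> \<Phi> y = \<Phi> z"
      using sj[of "\<Phi> x \<squnion>\<^bsub>L\<^esub> \<Phi> y"] c by auto
    have "\<Phi> x \<sqsubseteq>\<^bsub>L\<^esub> \<Phi> z" "\<Phi> y \<sqsubseteq>\<^bsub>L\<^esub> \<Phi> z"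
      unfolding z(2)[symmetric] using c by (auto intro: join_left join_right)
    then have "x \<squnion>\<^bsub>L\<^esub> y \<sqsubseteq>\<^bsub>L\<^esub> z" using ord c z(1) by (intro join_le) auto
    then have "\<Phi> (x \<squnion>\<^bsub>L\<^esub> y) \<sqsubseteq>\<^bsub>L\<^esub> \<Phi> x \<squnion>\<^bsub>L\<^esub> \<Phi> y" using ord c z by simp
    moreover have "\<Phi> x \<squnion>\<^bsub>L\<^esub> \<Phi> y \<sqsubseteq>\<^bsub>L\<^esub> \<Phi> (x \<squnion>\<^bsub>L\<^esub> y)"
      using c ord im[OF join_closed[OF xy]] join_left[OF xy] join_right[OF xy] by (intro join_le) auto
    ultimately show "\<Phi> (x \<squnion>\<^bsub>L\<^esub> y) = \<Phi> x \<squnion>\<^bsub>L\<^esub> \<Phi> y"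
      using c im by (intro le_antisym) auto
    obtain z where z: "z \<in> carrier L" "\<Phi> x \<sqinter>\<^bsub>L\<^esub> \<Phi> y = \<Phi> z"
      using sj[of "\<Phi> x \<sqinter>\<^bsub>L\<^esub> \<Phi> y"] c by auto
    have "\<Phi> z \<sqsubseteq>\<^bsub>L\<^esub> \<Phi> x" "\<Phi> z \<sqsubseteq>\<^bsub>L\<^esub> \<Phi> y"
      unfolding z(2)[symmetric] using c by (auto intro: meet_left meet_right)
    then have "z \<sqsubseteq>\<^bsub>L\<^esub> x \<sqinter>\<^bsub>L\<^esub> y" using ord c z(1) by (intro meet_le) auto
    then have "\<Phi> x \<sqinter>\<^bsub>L\<^esub> \<Phi> y \<sqsubseteq>\<^bsub>L\<^esub> \<Phi> (x \<sqinter>\<^bsub>L\<^esub> y)" using ord c z by simp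
    moreover have "\<Phi> (x \<sqinter>\<^bsub>L\<^esub> y) \<sqsubseteq>\<^bsub>L\<^esub> \<Phi> x \<sqinter>\<^bsub>L\<^esub> \<Phi> y"
      using c ord im[OF meet_closed[OF xy]] meet_left[OF xy] meet_right[OF xy] by (intro meet_le) auto
    ultimately show "\<Phi> (x \<sqinter>\<^bsub>L\<^esub> y) = \<Phi> x \<sqinter>\<^bsub>L\<^esub> \<Phi> y"
      using c im by (intro le_antisym) auto
  qed
  ultimately show ?thesis
    using assms unfolding lattice_automorphisms_def join_pres_def meet_pres_def by blast
qed

definition topologies :: "'a topology set" where
  "topologies = {T. topspace T = UNIV}"

definition coarser :: "'a topology \<Rightarrow> 'a topology \<Rightarrow> bool" where
  "coarser S T \<longleftrightarrow> (\<forall>U. openin S U \<longrightarrow> openin T U)"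

lemma carrier_topology_lattice: "carrier topology_lattice = topologies"
  by (simp add: topology_lattice_def topologies_def)

lemma lattice_automorphisms_topology_lattice:
  "\<Phi> \<in> lattice_automorphisms topology_lattice \<longleftrightarrow>
     \<Phi> \<in> Bij topologies \<and> (\<forall>S\<in>topologies. \<forall>T\<in>topologies. coarser (\<Phi> S) (\<Phi> T) \<longleftrightarrow> coarser S T)"
proof -
  have "S \<sqsubseteq>\<^bsub>topology_lattice\<^esub> T \<longleftrightarrow> coarser S T" for S T :: "'a topology"
    by (auto simp: topology_lattice_def coarser_def)
  moreover have "lattice (topology_lattice :: 'a topology gorder)"
    using complete_lattice_lattice complete_lattice_topology_lattice by blast
  ultimately show ?thesis
    by (simp add: lattice_automorphisms_eq carrier_topology_lattice)
qed

lemma coarser_antisym: "coarser S T \<Longrightarrow> coarser T S \<Longrightarrow> S = T"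
  by (auto simp: coarser_def topology_eq)

lemma openin_UNIV: "T \<in> topologies \<Longrightarrow> openin T UNIV"
  using openin_topspace[of T] by (simp add: topologies_def)

lemma topologiesI: "openin T UNIV \<Longrightarrow> T \<in> topologies"
  using openin_subset unfolding topologies_def by blast

lemma topological_family_openin: "T \<in> topologies \<Longrightarrow> topological_family {U. openin T U}"
  by (auto simp: topological_family_def istopology_def openin_UNIV)

lemma openin_topology_family:
  "topological_family \<T> \<Longrightarrow> openin (topology (\<lambda>U. U \<in> \<T>)) = (\<lambda>U. U \<in> \<T>)"
  by (simp add: topological_family_def topology_inverse')

lemma topology_family_mem: "topological_family \<T> \<Longrightarrow> topology (\<lambda>U. U \<in> \<T>) \<in> topologies"
  by (rule topologiesI) (simp add: openin_topology_family, simp add: topological_family_def)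

definition one_set_topology :: "'a set \<Rightarrow> 'a topology" where
  "one_set_topology A = topology (\<lambda>U. U \<in> {{}, A, UNIV})"

lemma openin_one_set_topology: "openin (one_set_topology A) U \<longleftrightarrow> U \<in> {{}, A, UNIV}"
proof -
  have "topological_family {{}, A, UNIV}"
    by (rule topological_family_finiteI; (elim insertE emptyE)?) simp_all
  then show ?thesis unfolding one_set_topology_def by (subst openin_topology_family) simp_all
qed

lemma one_set_topology_mem: "one_set_topology A \<in> topologies"
  by (rule topologiesI) (simp add: openin_one_set_topology)

lemma coarser_one_set_topology:
  "T \<in> topologies \<Longrightarrow> coarser (one_set_topology A) T \<longleftrightarrow> openin T A"
  using openin_UNIV[of T] by (auto simp: coarser_def openin_one_set_topology)

text \<open>Only the bottom element lies strictly below \<open>T\<close>, so \<open>T\<close> is an atom or the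
  bottom element. The condition is phrased by the order alone and therefore invariant under lattice
  automorphisms.\<close>

definition atom_or_bottom :: "'a topology \<Rightarrow> bool" where
  "atom_or_bottom T \<longleftrightarrow>
     (\<forall>S\<in>topologies. coarser S T \<longrightarrow> coarser T S \<or> (\<forall>R\<in>topologies. coarser S R))"

lemma atom_or_bottom_iff:
  assumes T: "T \<in> topologies"
  shows "atom_or_bottom T \<longleftrightarrow> (\<exists>A. T = one_set_topology A)"
proof
  assume *: "atom_or_bottom T"
  show "\<exists>A. T = one_set_topology A"
  proof (cases "\<exists>A. openin T A \<and> A \<noteq> {} \<and> A \<noteq> UNIV")
    case True
    then obtain A where A: "openin T A" "A \<noteq> {}" "A \<noteq> UNIV" by blast
    have c: "coarser (one_set_topology A) T" using coarser_one_set_topology[OF T] A by blast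
    have "\<not> coarser (one_set_topology A) (one_set_topology {})"
      using A by (auto simp: coarser_def openin_one_set_topology)
    then have "coarser T (one_set_topology A)"
      using *[unfolded atom_or_bottom_def, rule_format, OF one_set_topology_mem c]
        one_set_topology_mem[of "{}"] by blast
    then show ?thesis using c coarser_antisym by blast
  next
    case False
    then have "openin T U \<longleftrightarrow> openin (one_set_topology {}) U" for U
      using openin_UNIV[OF T] by (auto simp: openin_one_set_topology)
    then show ?thesis by (auto simp: topology_eq)
  qed
next
  assume "\<exists>A. T = one_set_topology A"
  then obtain A where A: "T = one_set_topology A" by blast
  show "atom_or_bottom T"
    unfolding atom_or_bottom_def
  proof (intro ballI impI)
    fix S :: "'a topology" assume S: "S \<in> topologies" "coarser S T"
    show "coarser T S \<or> (\<forall>R\<in>topologies. coarser S R)"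
    proof (cases "openin S A")
      case True
      then show ?thesis using coarser_one_set_topology[OF S(1)] A by blast
    next
      case False
      then have "openin S U \<Longrightarrow> U \<in> {{}, UNIV}" for U
        using S(2) unfolding A coarser_def openin_one_set_topology by blast
      then have "openin R U" if "R \<in> topologies" "openin S U" for R U
        using openin_UNIV[OF that(1)] openin_empty[of R] that(2)
        by (metis empty_iff insert_iff)
      then show ?thesis by (simp add: coarser_def)
    qed
  qed
qed

lemma one_set_topology_eq_iff:
  assumes "A \<notin> {{}, UNIV}"
  shows "one_set_topology A = one_set_topology B \<longleftrightarrow> A = B"
proof
  assume "one_set_topology A = one_set_topology B"
  then have "openin (one_set_topology B) A"
    by (metis openin_one_set_topology insertCI)
  then show "A = B" using assms by (simp add: openin_one_set_topology)
qed simp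

text \<open>A topology is determined by the topologies \<open>{\<emptyset>, A, X}\<close> below it, and these are
  permuted by an automorphism.\<close>

lemma lattice_automorphism_permutes_sets:
  fixes \<Phi> :: "'a topology \<Rightarrow> 'a topology"
  assumes \<Phi>: "\<Phi> \<in> lattice_automorphisms topology_lattice"
  obtains F where "topological_permutation F"
    "\<And>T A. T \<in> topologies \<Longrightarrow> openin (\<Phi> T) (F A) \<longleftrightarrow> openin T A"
proof -
  have bij: "bij_betw \<Phi> topologies topologies"
    using \<Phi> by (auto simp: lattice_automorphisms_topology_lattice Bij_def)
  have ord: "coarser (\<Phi> S) (\<Phi> T) \<longleftrightarrow> coarser S T" if "S \<in> topologies" "T \<in> topologies" for S T
    using \<Phi> that by (simp add: lattice_automorphisms_topology_lattice)
  have mem: "\<Phi> T \<in> topologies" if "T \<in> topologies" for T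
    using bij_betw_apply[OF bij that] .
  have sj: "\<exists>S\<in>topologies. T = \<Phi> S" if "T \<in> topologies" for T
    using bij that unfolding bij_betw_def by (metis image_iff)
  have inj: "S = T" if "\<Phi> S = \<Phi> T" "S \<in> topologies" "T \<in> topologies" for S T
    using bij that by (auto simp: bij_betw_def inj_on_def)
  have "atom_or_bottom (\<Phi> T) \<longleftrightarrow> atom_or_bottom T" if T: "T \<in> topologies" for T
  proof -
    have all: "(\<forall>S\<in>topologies. P S) \<longleftrightarrow> (\<forall>S\<in>topologies. P (\<Phi> S))" for P
      using sj mem by metis
    have "(\<forall>R\<in>topologies. coarser (\<Phi> S) R) \<longleftrightarrow> (\<forall>R\<in>topologies. coarser S R)"
      if "S \<in> topologies" for S
      by (subst all) (simp add: ord that)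
    then show ?thesis
      unfolding atom_or_bottom_def by (subst all) (simp add: ord T)
  qed
  then have irr: "(\<exists>B. \<Phi> T = one_set_topology B) \<longleftrightarrow> (\<exists>A. T = one_set_topology A)"
    if "T \<in> topologies" for T
    using that atom_or_bottom_iff mem by blast
  define G where "G A = (SOME B. \<Phi> (one_set_topology A) = one_set_topology B)" for A
  have G: "\<Phi> (one_set_topology A) = one_set_topology (G A)" for A
  proof -
    have "\<exists>A'. one_set_topology A = one_set_topology A'" by (rule exI, rule refl)
    then have "\<exists>B. \<Phi> (one_set_topology A) = one_set_topology B"
      by (simp only: irr[OF one_set_topology_mem])
    then show ?thesis unfolding G_def by (rule someI_ex)
  qed
  have triv: "B \<in> {{}, UNIV} \<longleftrightarrow> (\<forall>T\<in>topologies. coarser (one_set_topology B) T)" for B :: "'a set"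
  proof
    assume "\<forall>T\<in>topologies. coarser (one_set_topology B) T"
    then have "coarser (one_set_topology B) (one_set_topology {})"
      using one_set_topology_mem by blast
    then show "B \<in> {{}, UNIV}" by (auto simp: coarser_def openin_one_set_topology)
  qed (use openin_UNIV in \<open>auto simp: coarser_one_set_topology\<close>)
  have Gtriv: "G A \<in> {{}, UNIV} \<longleftrightarrow> A \<in> {{}, UNIV}" for A
  proof -
    have "(\<forall>T\<in>topologies. coarser (\<Phi> (one_set_topology A)) T) \<longleftrightarrow>
        (\<forall>T\<in>topologies. coarser (\<Phi> (one_set_topology A)) (\<Phi> T))"
      using sj mem by metis
    also have "\<dots> \<longleftrightarrow> (\<forall>T\<in>topologies. coarser (one_set_topology A) T)"
      by (simp add: ord one_set_topology_mem)
    finally show ?thesis unfolding triv G .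
  qed
  \<comment> \<open>\<open>\<emptyset>\<close> and \<open>UNIV\<close> both represent the bottom element, so \<open>F\<close> fixes them by convention.\<close>
  define F where "F A = (if A \<in> {{}, UNIV} then A else G A)" for A
  have F1: "openin (\<Phi> T) (F A) \<longleftrightarrow> openin T A" if T: "T \<in> topologies" for T A
  proof (cases "A \<in> {{}, UNIV}")
    case True
    then show ?thesis using openin_UNIV[OF T] openin_UNIV[OF mem[OF T]] by (auto simp: F_def)
  next
    case False
    have "openin (\<Phi> T) (G A) \<longleftrightarrow> coarser (\<Phi> (one_set_topology A)) (\<Phi> T)"
      by (simp only: G coarser_one_set_topology[OF mem[OF T]])
    also have "\<dots> \<longleftrightarrow> openin T A"
      using ord[OF one_set_topology_mem T] coarser_one_set_topology[OF T] by blast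
    finally show ?thesis unfolding F_def using False by (simp only: if_False)
  qed
  have FG: "F A = B \<longleftrightarrow> \<Phi> (one_set_topology A) = one_set_topology B"
    if "A \<notin> {{}, UNIV}" for A B
  proof -
    have "G A \<notin> {{}, UNIV}" using that Gtriv by blast
    moreover have "F A = G A" unfolding F_def using that by (simp only: if_False)
    ultimately show ?thesis unfolding G using one_set_topology_eq_iff[of "G A" B] by blast
  qed
  have Fid: "F A = A" if "A \<in> {{}, UNIV}" for A
    unfolding F_def using that by (rule if_P)
  have Ftriv: "F A \<in> {{}, UNIV} \<longleftrightarrow> A \<in> {{}, UNIV}" for A
    unfolding F_def using Gtriv[of A] by (cases "A \<in> {{}, UNIV}") (simp_all only: if_True if_False)
  have "bij F"
  proof (rule bijI)
    show "inj F"
    proof (rule injI)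
      fix A B assume AB: "F A = F B"
      show "A = B"
      proof (cases "A \<in> {{}, UNIV}")
        case True
        then have "B \<in> {{}, UNIV}" using AB Ftriv by metis
        then show ?thesis using AB True Fid by metis
      next
        case False
        then have B: "B \<notin> {{}, UNIV}" using AB Ftriv by metis
        have "\<Phi> (one_set_topology A) = \<Phi> (one_set_topology B)"
          using FG[OF False, of "F B"] FG[OF B, of "F B"] AB by metis
        then show ?thesis
          using inj one_set_topology_mem one_set_topology_eq_iff[OF False] by blast
      qed
    qed
    have "\<exists>A. F A = B" for B
    proof (cases "B \<in> {{}, UNIV}")
      case False
      obtain S where S: "S \<in> topologies" "one_set_topology B = \<Phi> S"
        using sj one_set_topology_mem by blast
      then obtain A where A: "S = one_set_topology A" using irr by metis
      have "A \<notin> {{}, UNIV}"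
      proof
        assume "A \<in> {{}, UNIV}"
        then have "\<forall>T\<in>topologies. coarser S T" using triv A by blast
        then have "\<forall>T\<in>topologies. coarser (one_set_topology B) T" using ord S sj by metis
        then show False using triv False by blast
      qed
      then show ?thesis using FG S A by metis
    qed (auto simp: F_def)
    then show "surj F" by (metis surjI)
  qed
  have image: "F ` {U. openin T U} = {U. openin (\<Phi> T) U}" if "T \<in> topologies" for T
  proof
    show "{U. openin (\<Phi> T) U} \<subseteq> F ` {U. openin T U}"
    proof
      fix U assume U: "U \<in> {U. openin (\<Phi> T) U}"
      obtain A where A: "U = F A" using \<open>bij F\<close> by (meson bij_pointE)
      then have "openin T A" using U F1[OF that] by simp
      then show "U \<in> F ` {U. openin T U}" using A by blast
    qed
  qed (auto simp: F1[OF that])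
  have "topological_permutation F"
    unfolding topological_permutation_def
  proof (intro conjI allI iffI)
    show "bij F" by fact
  next
    fix \<T> :: "'a set set" assume *: "topological_family \<T>"
    have "F ` \<T> = {U. openin (\<Phi> (topology (\<lambda>U. U \<in> \<T>))) U}"
      using image[OF topology_family_mem[OF *]] by (simp add: openin_topology_family[OF *])
    then show "topological_family (F ` \<T>)"
      using topological_family_openin[OF mem[OF topology_family_mem[OF *]]] by simp
  next
    fix \<T> :: "'a set set" assume *: "topological_family (F ` \<T>)"
    obtain S where S: "S \<in> topologies" "topology (\<lambda>U. U \<in> F ` \<T>) = \<Phi> S"
      using sj[OF topology_family_mem[OF *]] by blast
    have "F ` \<T> = F ` {U. openin S U}"
      unfolding image[OF S(1)] S(2)[symmetric] openin_topology_family[OF *] by simp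
    then have "\<T> = {U. openin S U}"
      by (simp only: inj_image_eq_iff[OF bij_is_inj[OF \<open>bij F\<close>]])
    then show "topological_family \<T>" using topological_family_openin[OF S(1)] by simp
  qed
  then show ?thesis using that F1 by blast
qed

text \<open>The quotient topology along \<open>f\<close>; for a bijection it is the image of the topology.\<close>

definition push :: "('a \<Rightarrow> 'b) \<Rightarrow> 'a topology \<Rightarrow> 'b topology" where
  "push f T = topology (\<lambda>U. openin T (f -` U))"

text \<open>The closed sets of \<open>T\<close> as open sets. This is a topology when the underlying set is
  finite.\<close>

definition closed_set_topology :: "'a topology \<Rightarrow> 'a topology" where
  "closed_set_topology T = topology (\<lambda>U. openin T (- U))"

lemma openin_push: "openin (push f T) U \<longleftrightarrow> openin T (f -` U)"
proof -
  have "istopology (\<lambda>U. openin T (f -` U))"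
    by (auto simp: istopology_def vimage_Union)
  then show ?thesis by (simp add: push_def topology_inverse')
qed

lemma push_mem: "T \<in> topologies \<Longrightarrow> push f T \<in> topologies"
  by (rule topologiesI) (simp add: openin_push openin_UNIV)

lemma push_push: "push f (push g T) = push (f \<circ> g) T"
  by (simp add: topology_eq openin_push vimage_comp)

lemma push_id: "push id T = T"
  by (simp add: topology_eq openin_push)

lemma openin_closed_set_topology:
  assumes "finite (UNIV :: 'a set)" "T \<in> topologies"
  shows "openin (closed_set_topology T) (U :: 'a set) \<longleftrightarrow> openin T (- U)"
proof -
  have *: "uminus ` {U. openin T U} = {U. openin T (- U)}"
    by (auto intro!: image_eqI[of _ uminus "- _"])
  then have "topological_family {U. openin T (- U)}"
    using topological_family_uminus[OF assms(1) topological_family_openin[OF assms(2)]] by simp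
  then show ?thesis
    using openin_topology_family[of "{U. openin T (- U)}"] by (simp add: closed_set_topology_def)
qed

lemma closed_set_topology_mem:
  "finite (UNIV :: 'a set) \<Longrightarrow> (T :: 'a topology) \<in> topologies \<Longrightarrow> closed_set_topology T \<in> topologies"
  by (rule topologiesI) (simp add: openin_closed_set_topology)

lemma closed_set_topology_twice:
  "finite (UNIV :: 'a set) \<Longrightarrow> (T :: 'a topology) \<in> topologies \<Longrightarrow>
     closed_set_topology (closed_set_topology T) = T"
  using closed_set_topology_mem[of T] by (simp add: topology_eq openin_closed_set_topology)

lemma closed_set_topology_push:
  "finite (UNIV :: 'a set) \<Longrightarrow> (T :: 'a topology) \<in> topologies \<Longrightarrow>
     closed_set_topology (push (f :: 'a \<Rightarrow> 'a) T) = push f (closed_set_topology T)"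
  using push_mem[of T f]
  by (simp add: topology_eq openin_closed_set_topology openin_push vimage_Compl)

theorem lattice_automorphism_cases:
  fixes \<Phi> :: "'a topology \<Rightarrow> 'a topology"
  assumes \<Phi>: "\<Phi> \<in> lattice_automorphisms topology_lattice"
    and big: "\<And>a b c :: 'a. \<exists>d. d \<noteq> a \<and> d \<noteq> b \<and> d \<noteq> c"
  obtains f where "bij f" "\<And>T. T \<in> topologies \<Longrightarrow> \<Phi> T = push f T"
  | f where "finite (UNIV :: 'a set)" "bij f"
      "\<And>T. T \<in> topologies \<Longrightarrow> \<Phi> T = push f (closed_set_topology T)"
proof -
  obtain F where F: "topological_permutation F"
    and op: "\<And>T A. T \<in> topologies \<Longrightarrow> openin (\<Phi> T) (F A) \<longleftrightarrow> openin T A"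
    using lattice_automorphism_permutes_sets[OF \<Phi>] by blast
  have mem: "\<Phi> T \<in> topologies" if "T \<in> topologies" for T
  proof -
    have "bij_betw \<Phi> topologies topologies"
      using \<Phi> by (simp add: lattice_automorphisms_topology_lattice Bij_def)
    then show ?thesis using that by (rule bij_betw_apply)
  qed
  note triv = openin_UNIV[OF mem] openin_UNIV
  show thesis
    using F big
  proof (cases rule: topological_permutation_cases)
    case (1 f)
    have "\<Phi> T = push f T" if T: "T \<in> topologies" for T
      unfolding topology_eq openin_push
    proof
      fix U
      have U: "f ` f -` U = U" using 1(1) by (simp add: bij_is_surj surj_image_vimage_eq)
      show "openin (\<Phi> T) U \<longleftrightarrow> openin T (f -` U)"
      proof (cases "U = {} \<or> U = UNIV")
        case False
        moreover have "f ` UNIV = UNIV" using 1(1) by (rule bij_is_surj)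
        ultimately have "f -` U \<noteq> {}" "f -` U \<noteq> UNIV" using U by (metis image_empty)+
        then show ?thesis using op[OF T, of "f -` U"] 1(2)[of "f -` U"] U by simp
      qed (use triv[OF T] in auto)
    qed
    then show ?thesis using that(1)[OF 1(1)] by blast
  next
    case (2 f)
    have "\<Phi> T = push f (closed_set_topology T)" if T: "T \<in> topologies" for T
      unfolding topology_eq openin_push openin_closed_set_topology[OF 2(1) T]
    proof
      fix U
      have U: "- f ` (- f -` U) = U"
        using 2(2) by (simp add: bij_is_surj surj_image_vimage_eq vimage_Compl[symmetric])
      show "openin (\<Phi> T) U \<longleftrightarrow> openin T (- f -` U)"
      proof (cases "U = {} \<or> U = UNIV")
        case False
        moreover have "f ` UNIV = UNIV" using 2(2) by (rule bij_is_surj)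
        ultimately have "- f -` U \<noteq> {}" "- f -` U \<noteq> UNIV"
          using U by (metis image_empty Compl_empty_eq Compl_UNIV_eq)+
        then show ?thesis using op[OF T, of "- f -` U"] 2(3)[of "- f -` U"] U by simp
      qed (use triv[OF T] in auto)
    qed
    then show ?thesis using that(2)[OF 2(1,2)] by blast
  qed
qed

lemma restrict_lattice_automorphismI:
  assumes "\<And>T. T \<in> topologies \<Longrightarrow> \<Phi> T \<in> topologies" "\<And>T. T \<in> topologies \<Longrightarrow> \<Psi> T \<in> topologies"
    and "\<And>T. T \<in> topologies \<Longrightarrow> \<Psi> (\<Phi> T) = T" "\<And>T. T \<in> topologies \<Longrightarrow> \<Phi> (\<Psi> T) = T"
    and "\<And>S T. S \<in> topologies \<Longrightarrow> T \<in> topologies \<Longrightarrow> coarser (\<Phi> S) (\<Phi> T) \<longleftrightarrow> coarser S T"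
  shows "restrict \<Phi> topologies \<in> lattice_automorphisms topology_lattice"
proof -
  have "bij_betw \<Phi> topologies topologies"
    by (rule bij_betw_byWitness[where f' = \<Psi>]) (use assms in auto)
  then have "restrict \<Phi> topologies \<in> Bij topologies"
    by (simp add: Bij_def bij_betw_restrict_eq)
  then show ?thesis
    using assms(5) by (simp add: lattice_automorphisms_topology_lattice)
qed

lemma coarser_push:
  assumes "bij f"
  shows "coarser (push f S) (push f T) \<longleftrightarrow> coarser S T"
proof -
  have "A = f -` f ` A" for A using assms by (simp add: bij_is_inj inj_vimage_image_eq)
  then show ?thesis unfolding coarser_def openin_push by metis
qed

lemma coarser_closed_set_topology:
  "finite (UNIV :: 'a set) \<Longrightarrow> S \<in> topologies \<Longrightarrow> (T :: 'a topology) \<in> topologies \<Longrightarrow>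
     coarser (closed_set_topology S) (closed_set_topology T) \<longleftrightarrow> coarser S T"
  unfolding coarser_def by (simp add: openin_closed_set_topology) (metis double_complement)

lemma restrict_push_lattice_automorphism:
  fixes f :: "'a \<Rightarrow> 'a"
  assumes "bij f"
  shows "restrict (push f) topologies \<in> lattice_automorphisms topology_lattice"
  by (rule restrict_lattice_automorphismI[where \<Psi> = "push (inv_into UNIV f)"])
    (use assms in \<open>simp_all add: push_mem push_push coarser_push push_id
      bij_is_inj bij_is_surj surj_iff[THEN iffD1]\<close>)

lemma restrict_push_closed_lattice_automorphism:
  fixes f :: "'a \<Rightarrow> 'a"
  assumes "finite (UNIV :: 'a set)" "bij f"
  shows "(\<lambda>T\<in>topologies. push f (closed_set_topology T)) \<in> lattice_automorphisms topology_lattice"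
proof (rule restrict_lattice_automorphismI[where \<Psi> = "\<lambda>T. closed_set_topology (push (inv_into UNIV f) T)"])
  note m = push_mem closed_set_topology_mem[OF assms(1)]
  show "push f (closed_set_topology T) \<in> topologies"
    "closed_set_topology (push (inv_into UNIV f) T) \<in> topologies" if "T \<in> topologies" for T
    using that by (blast intro: m)+
  have id: "inv_into UNIV f \<circ> f = id" "f \<circ> inv_into UNIV f = id"
    using assms(2) by (simp_all add: bij_is_inj bij_is_surj surj_iff[THEN iffD1])
  show "closed_set_topology (push (inv_into UNIV f) (push f (closed_set_topology T))) = T"
    "push f (closed_set_topology (closed_set_topology (push (inv_into UNIV f) T))) = T"
    if "T \<in> topologies" for T
    using that m(1)[OF that, of "inv_into UNIV f"]
    by (simp_all add: push_push id push_id closed_set_topology_twice[OF assms(1)])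
  show "coarser (push f (closed_set_topology S)) (push f (closed_set_topology T)) \<longleftrightarrow> coarser S T"
    if "S \<in> topologies" "T \<in> topologies" for S T
    using that by (simp add: coarser_push[OF assms(2)] coarser_closed_set_topology[OF assms(1)])
qed

section \<open>Subspaces, parallelism and semilinear maps\<close>

text \<open>Lines through the origin go to such lines, and parallel lines to parallel lines. A sum of
  independent vectors is the fourth vertex of a parallelogram, so it is preserved; dependent vectors
  are handled by adding an auxiliary vector outside their line. The scalar factor on
  \<open>x\<close> and the one on an independent \<open>e\<close> agree because both coincide with the one on
  \<open>x + e\<close>.\<close>

lemma (in vector_space) parallel_preserving_imp_semilinear:
  assumes \<phi>: "bij \<phi>" and \<phi>0: "\<phi> 0 = 0"
    and sub: "\<And>W. subspace W \<Longrightarrow> subspace (\<phi> ` W)"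
    and sub': "\<And>W. subspace W \<Longrightarrow> subspace (\<phi> -` W)"
    and par: "\<And>W x y. subspace W \<Longrightarrow> x - y \<in> W \<Longrightarrow> \<phi> x - \<phi> y \<in> \<phi> ` W"
    and dim2: "\<And>x. \<exists>z. z \<notin> span {x}"
  obtains \<psi> where "field_automorphism \<psi>" "semilinear scale \<psi> \<phi>"
proof -
  have inj: "\<phi> x = \<phi> y \<longleftrightarrow> x = y" for x y using \<phi> by (simp add: bij_is_inj inj_eq)
  have line: "\<phi> ` span {x} = span {\<phi> x}" for x
  proof
    show "span {\<phi> x} \<subseteq> \<phi> ` span {x}"
      using sub[OF subspace_span] by (intro span_minimal) (auto intro: span_base)
    have "span {x} \<subseteq> \<phi> -` span {\<phi> x}"
      using sub'[OF subspace_span] by (intro span_minimal) (auto intro: span_base)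
    then show "\<phi> ` span {x} \<subseteq> span {\<phi> x}" by blast
  qed
  have mem_line: "\<phi> y \<in> span {\<phi> x} \<longleftrightarrow> y \<in> span {x}" for x y
    unfolding line[symmetric] using \<phi> by (simp add: bij_is_inj inj_image_mem_iff)
  have add_indep: "\<phi> (x + y) = \<phi> x + \<phi> y" if y: "y \<notin> span {x}" for x y
  proof -
    have "\<phi> (x + y) - \<phi> x \<in> span {\<phi> y}"
      using par[OF subspace_span, of "x + y" x "{y}"] by (simp add: line span_base)
    moreover have "\<phi> (x + y) - \<phi> y \<in> span {\<phi> x}"
      using par[OF subspace_span, of "x + y" y "{x}"] by (simp add: line span_base)
    ultimately obtain a b where ab: "\<phi> (x + y) - \<phi> x = scale b (\<phi> y)" "\<phi> (x + y) - \<phi> y = scale a (\<phi> x)"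
      unfolding span_singleton by blast
    have "scale (1 - b) (\<phi> y) = \<phi> y - (\<phi> (x + y) - \<phi> x)"
      by (simp only: ab(1) scale_left_diff_distrib scale_one)
    also have "\<dots> = \<phi> x - (\<phi> (x + y) - \<phi> y)" by simp
    also have "\<dots> = scale (1 - a) (\<phi> x)"
      by (simp only: ab(2) scale_left_diff_distrib scale_one)
    finally have eq: "scale (1 - b) (\<phi> y) = scale (1 - a) (\<phi> x)" .
    have "b = 1"
    proof (rule ccontr)
      assume "b \<noteq> 1"
      then have "\<phi> y = scale (inverse (1 - b)) (scale (1 - b) (\<phi> y))" by simp
      also have "\<dots> \<in> span {\<phi> x}" unfolding eq by (intro span_scale span_base) simp
      finally show False using mem_line y by blast
    qed
    then show ?thesis using ab(1) by (simp add: algebra_simps)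
  qed
  have add: "\<phi> (x + y) = \<phi> x + \<phi> y" for x y
  proof (cases "y \<in> span {x}")
    case True
    \<comment> \<open>In both bracketings of \<open>x + y + z\<close>, every sum except \<open>x + y\<close> is covered by \<open>add_indep\<close>.\<close>
    obtain z where z: "z \<notin> span {x}" using dim2 by blast
    have yx: "span {y} \<subseteq> span {x}" "span {x + y} \<subseteq> span {x}"
      using True span_base[of x "{x}"] by (simp_all add: span_minimal span_add)
    have "y + z \<notin> span {x}"
      using span_diff[of "y + z" "{x}" y] True z by auto
    then have "\<phi> (x + (y + z)) = \<phi> x + \<phi> (y + z)" by (rule add_indep)
    also have "\<phi> (y + z) = \<phi> y + \<phi> z" using z yx by (intro add_indep) blast
    finally have "\<phi> (x + y + z) = \<phi> x + \<phi> y + \<phi> z" by (simp add: add.assoc)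
    moreover have "\<phi> (x + y + z) = \<phi> (x + y) + \<phi> z" using z yx by (intro add_indep) blast
    ultimately show ?thesis by simp
  qed (rule add_indep)
  have "\<exists>c. \<phi> (scale \<alpha> x) = scale c (\<phi> x)" for \<alpha> x
  proof -
    have "scale \<alpha> x \<in> span {x}" by (intro span_scale span_base) simp
    then have "\<phi> (scale \<alpha> x) \<in> span {\<phi> x}" by (simp add: mem_line)
    then show ?thesis by (auto simp: span_singleton)
  qed
  then obtain c where c: "\<And>\<alpha> x. \<phi> (scale \<alpha> x) = scale (c \<alpha> x) (\<phi> x)" by metis
  obtain e where e: "e \<notin> span {0}" using dim2 by blast
  then have e0: "e \<noteq> 0" "\<phi> e \<noteq> 0" using inj[of e 0] \<phi>0 by (auto intro: span_base)
  define \<psi> where "\<psi> \<alpha> = c \<alpha> e" for \<alpha>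
  have indep: "\<phi> (scale \<alpha> x) = scale (\<psi> \<alpha>) (\<phi> x)" if x: "x \<notin> span {e}" for \<alpha> x
  proof -
    have "scale (c \<alpha> (x + e)) (\<phi> x + \<phi> e) = \<phi> (scale \<alpha> (x + e))" by (simp add: c add)
    also have "\<dots> = scale (c \<alpha> x) (\<phi> x) + scale (\<psi> \<alpha>) (\<phi> e)"
      by (simp add: scale_right_distrib add c \<psi>_def)
    finally have eq: "scale (c \<alpha> (x + e) - c \<alpha> x) (\<phi> x) = scale (\<psi> \<alpha> - c \<alpha> (x + e)) (\<phi> e)"
      by (simp add: algebra_simps)
    have 1: "c \<alpha> (x + e) = c \<alpha> x"
    proof (rule ccontr)
      define d where "d = c \<alpha> (x + e) - c \<alpha> x"
      assume "c \<alpha> (x + e) \<noteq> c \<alpha> x"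
      then have "d \<noteq> 0" by (simp add: d_def)
      then have "\<phi> x = scale (inverse d) (scale d (\<phi> x))" by simp
      also have "\<dots> \<in> span {\<phi> e}" unfolding d_def eq by (intro span_scale span_base) simp
      finally show False using mem_line x by blast
    qed
    then have "\<psi> \<alpha> = c \<alpha> (x + e)" using eq e0 by simp
    then show ?thesis using 1 c by simp
  qed
  have scale: "\<phi> (scale \<alpha> x) = scale (\<psi> \<alpha>) (\<phi> x)" for \<alpha> x
  proof (cases "x \<in> span {e}")
    case True
    obtain z where z: "z \<notin> span {e}" using dim2 by blast
    then have "x + z \<notin> span {e}" using span_diff[of "x + z" "{e}" x] True by auto
    then have "\<phi> (scale \<alpha> (x + z)) = scale (\<psi> \<alpha>) (\<phi> (x + z))" by (rule indep)
    then show ?thesis by (simp add: scale_right_distrib add indep[OF z])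
  qed (rule indep)
  have "field_automorphism \<psi>"
    unfolding field_automorphism_def
  proof (intro conjI allI)
    have cancel: "a = b" if "scale a (\<phi> e) = scale b (\<phi> e)" for a b
      using that e0 by simp
    show "\<psi> 1 = 1" using scale[of 1 e] by (intro cancel) simp
    fix a b
    show "\<psi> (a + b) = \<psi> a + \<psi> b"
      by (rule cancel) (simp add: scale_left_distrib add flip: scale)
    have "scale (\<psi> (a * b)) (\<phi> e) = \<phi> (scale a (scale b e))"
      by (simp only: scale[symmetric] scale_scale)
    also have "\<dots> = scale (\<psi> a * \<psi> b) (\<phi> e)" unfolding scale by (rule scale_scale)
    finally show "\<psi> (a * b) = \<psi> a * \<psi> b" by (rule cancel)
  next
    show "bij \<psi>"
    proof (rule bijI)
      show "inj \<psi>"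
      proof (rule injI)
        fix a b assume "\<psi> a = \<psi> b"
        then have "\<phi> (scale a e) = \<phi> (scale b e)" by (simp add: scale)
        then show "a = b" using inj e0 by simp
      qed
      have "\<exists>a. d = \<psi> a" for d
      proof -
        have "scale d (\<phi> e) \<in> \<phi> ` span {e}" unfolding line by (intro span_scale span_base) simp
        then obtain a where "scale d (\<phi> e) = \<phi> (scale a e)" by (auto simp: span_singleton)
        then have "scale d (\<phi> e) = scale (\<psi> a) (\<phi> e)" by (simp add: scale)
        then show ?thesis using e0 by auto
      qed
      then show "surj \<psi>" by blast
    qed
  qed
  moreover have "semilinear scale \<psi> \<phi>" using add scale by (simp add: semilinear_def)
  ultimately show ?thesis using that by blast
qed

lemma (in vector_space) notin_span_singleton_of_vdim:
  assumes "2 \<le> vdim scale"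
  shows "\<exists>z. z \<notin> span {x}"
proof (rule ccontr)
  assume "\<nexists>z. z \<notin> span {x}"
  then have sp: "span {x} = UNIV" by blast
  have "vdim scale = enat (dim UNIV)"
    unfolding vdim_def by (rule if_P) (rule exI[of _ "{x}"], simp only: sp finite.intros simp_thms)
  moreover have "dim UNIV \<le> card {x}"
    by (rule dim_le_card) (simp_all only: sp finite.intros subset_UNIV)
  then have "enat (dim UNIV) \<le> enat 1" by simp
  ultimately have "(2 :: enat) \<le> enat 1" using assms by (metis order_trans)
  then show False by (simp add: numeral_eq_enat)
qed

lemma (in vector_space) four_elements:
  assumes dim2: "\<And>x. \<exists>z. z \<notin> span {x}"
  shows "\<exists>d. d \<noteq> a \<and> d \<noteq> b \<and> d \<noteq> (c :: 'b)"
proof -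
  obtain e where e: "e \<notin> span {0}" using dim2 by blast
  obtain z where z: "z \<notin> span {e}" using dim2 by blast
  have "e \<noteq> 0" "z \<noteq> 0" "z \<noteq> e" "e + z \<noteq> 0"
    using e z span_zero[of "{0}"] span_zero[of "{e}"] span_base[of e "{e}"] span_neg[of e "{e}"]
    by (auto simp only: add_eq_0_iff insertI1 simp_thms)
  then have 4: "card {0, e, z, e + z} = 4" by simp
  have 3: "card {a, b, c} \<le> 3" by (simp add: card_insert_if)
  have "\<not> {0, e, z, e + z} \<subseteq> {a, b, c}"
  proof
    assume "{0, e, z, e + z} \<subseteq> {a, b, c}"
    then have "card {0, e, z, e + z} \<le> card {a, b, c}" by (rule card_mono[rotated]) simp
    then show False using 3 4 by linarith
  qed
  then show ?thesis by blast
qed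

text \<open>Subspaces are intersections of hyperplanes.\<close>

lemma (in vector_space) separating_functional:
  assumes "subspace W" "v \<notin> W"
  obtains f where "Vector_Spaces.linear scale (*) f" "\<And>w. w \<in> W \<Longrightarrow> f w = 0" "f v \<noteq> 0"
proof -
  interpret vector_space_pair scale "(*) :: 'a \<Rightarrow> 'a \<Rightarrow> 'a" ..
  obtain B where B: "B \<subseteq> W" "independent B" "W \<subseteq> span B"
    using maximal_independent_subset by blast
  have "span B = W" using B assms(1) span_minimal by blast
  then have "independent (insert v B)" using assms(2) B(2) by (simp add: independent_insert)
  then obtain f where f: "Vector_Spaces.linear scale (*) f"
    "\<forall>x\<in>insert v B. f x = (if x = v then 1 else 0)"
    using linear_independent_extend[of "insert v B" "\<lambda>x. if x = v then 1 else 0"] by blast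
  have "v \<notin> B" using B assms(2) by blast
  have "f b = 0" if "b \<in> B" for b
    using that \<open>v \<notin> B\<close> f(2) by (metis insertCI)
  then have "f w = 0" if "w \<in> W" for w
    using linear_eq_0_on_span[OF f(1), of B w] that \<open>span B = W\<close> by blast
  moreover have "f v \<noteq> 0" using f(2) by simp
  ultimately show ?thesis using that[OF f(1)] by blast
qed

section \<open>Vector topologies and their inseparable points\<close>

lemma continuous_map_vimage:
  "continuous_map S T f \<Longrightarrow> S \<in> topologies \<Longrightarrow> openin T U \<Longrightarrow> openin S (f -` U)"
  using openin_continuous_map_preimage[of S T f U] by (simp add: topologies_def vimage_def)

lemma continuous_map_push: "T \<in> topologies \<Longrightarrow> continuous_map T (push f T) f"
  using push_mem[of T f] by (auto simp: continuous_map_def topologies_def openin_push vimage_def)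

lemma continuous_map_push_inv:
  assumes "bij f" "T \<in> topologies"
  shows "continuous_map (push f T) T (inv_into UNIV f)"
proof -
  have "push (inv_into UNIV f) (push f T) = T"
    using assms(1) by (simp add: push_push push_id bij_is_inj)
  then show ?thesis using continuous_map_push[OF push_mem[OF assms(2)]] by metis
qed

locale topological_field_vector_space = vector_space smul
  for smul :: "'k::topological_field \<Rightarrow> 'v::ab_group_add \<Rightarrow> 'v"
begin

lemma vector_topology_mem: "T \<in> vector_topologies smul \<Longrightarrow> T \<in> topologies"
  by (simp add: vector_topologies_def topologies_def)

lemma openin_translation_vimage:
  assumes "T \<in> vector_topologies smul" "openin T U"
  shows "openin T ((\<lambda>x. a + x) -` U)"
proof -
  have "continuous_map T T ((\<lambda>(x, y). x + y) \<circ> (\<lambda>x. (a, x)))"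
    using assms(1) vector_topology_mem[OF assms(1)]
    by (intro continuous_map_compose[of _ "prod_topology T T"] continuous_map_pairedI)
      (auto simp: vector_topologies_def topologies_def)
  then show ?thesis
    using continuous_map_vimage[OF _ vector_topology_mem[OF assms(1)] assms(2)] by (simp add: comp_def)
qed

lemma openin_scaling_vimage:
  assumes "T \<in> vector_topologies smul" "openin T U"
  shows "openin T (smul \<alpha> -` U)"
proof -
  have "continuous_map T T ((\<lambda>(\<alpha>, x). smul \<alpha> x) \<circ> (\<lambda>x. (\<alpha>, x)))"
    using assms(1)
    by (intro continuous_map_compose[of _ "prod_topology euclidean T"] continuous_map_pairedI)
      (auto simp: vector_topologies_def)
  then show ?thesis
    using continuous_map_vimage[OF _ vector_topology_mem[OF assms(1)] assms(2)] by (simp add: comp_def)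
qed

lemma open_scalar_vimage:
  assumes "T \<in> vector_topologies smul" "openin T U"
  shows "open ((\<lambda>\<alpha>. smul \<alpha> x) -` U)"
proof -
  have "continuous_map euclidean T ((\<lambda>(\<alpha>, x). smul \<alpha> x) \<circ> (\<lambda>\<alpha>. (\<alpha>, x)))"
    using assms(1)
    by (intro continuous_map_compose[of _ "prod_topology euclidean T"] continuous_map_pairedI)
      (auto simp: vector_topologies_def)
  then show ?thesis
    using continuous_map_vimage[of euclidean T _ U] assms(2) by (simp add: comp_def topologies_def)
qed

text \<open>Translations are homeomorphisms of every vector topology.\<close>

lemma push_translation:
  assumes "T \<in> vector_topologies smul"
  shows "push (\<lambda>x. a + x) T = T"
  unfolding topology_eq openin_push
proof (intro allI iffI)
  fix U assume "openin T ((\<lambda>x. a + x) -` U)"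
  then have "openin T ((\<lambda>x. - a + x) -` ((\<lambda>x. a + x) -` U))"
    by (rule openin_translation_vimage[OF assms])
  then show "openin T U" by (simp add: vimage_def)
qed (rule openin_translation_vimage[OF assms])

text \<open>In a vector topology this is the closure of \<open>{0}\<close>. The symmetric formulation by
  inseparability is the one that every permutation of the points transports.\<close>

definition zero_closure :: "'v topology \<Rightarrow> 'v set" where
  "zero_closure T = {w. \<forall>U. openin T U \<longrightarrow> (0 \<in> U \<longleftrightarrow> w \<in> U)}"

lemma diff_mem_zero_closure_iff:
  assumes T: "T \<in> vector_topologies smul"
  shows "x - y \<in> zero_closure T \<longleftrightarrow> (\<forall>U. openin T U \<longrightarrow> (x \<in> U \<longleftrightarrow> y \<in> U))"
proof
  assume *: "x - y \<in> zero_closure T"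
  show "\<forall>U. openin T U \<longrightarrow> (x \<in> U \<longleftrightarrow> y \<in> U)"
  proof (intro allI impI)
    fix U assume "openin T U"
    from openin_translation_vimage[OF T this, of y] show "x \<in> U \<longleftrightarrow> y \<in> U"
      using * by (auto simp: zero_closure_def dest!: spec[of _ "(+) y -` U"])
  qed
next
  assume *: "\<forall>U. openin T U \<longrightarrow> (x \<in> U \<longleftrightarrow> y \<in> U)"
  have "0 \<in> U \<longleftrightarrow> x - y \<in> U" if "openin T U" for U
    using *[rule_format, OF openin_translation_vimage[OF T that, of "- y"]] by simp
  then show "x - y \<in> zero_closure T" by (simp add: zero_closure_def)
qed

lemma subspace_zero_closure:
  assumes T: "T \<in> vector_topologies smul"
  shows "subspace (zero_closure T)"
proof (rule subspaceI)
  show "0 \<in> zero_closure T" by (simp add: zero_closure_def)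
  fix x y assume x: "x \<in> zero_closure T"
  show "smul c x \<in> zero_closure T" for c
    unfolding zero_closure_def
  proof (intro CollectI allI impI)
    fix U assume "openin T U"
    then have "0 \<in> smul c -` U \<longleftrightarrow> x \<in> smul c -` U"
      using openin_scaling_vimage[OF T] x unfolding zero_closure_def by blast
    then show "0 \<in> U \<longleftrightarrow> smul c x \<in> U" by simp
  qed
  assume y: "y \<in> zero_closure T"
  have "(x + y) - y \<in> zero_closure T" using x by simp
  then have "x + y \<in> U \<longleftrightarrow> y \<in> U" if "openin T U" for U
    using diff_mem_zero_closure_iff[OF T] that by blast
  then show "x + y \<in> zero_closure T" using y by (simp add: zero_closure_def)
qed

text \<open>The initial topology of \<open>f\<close>. On a field that is not discrete, these are the simplest
  vector topologies at hand: the partition into the cosets of a hyperplane would not make scalar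
  multiplication continuous.\<close>

definition functional_topology :: "('v \<Rightarrow> 'k) \<Rightarrow> 'v topology" where
  "functional_topology f = pullback_topology UNIV f euclidean"

lemma openin_functional_topology: "openin (functional_topology f) U \<longleftrightarrow> (\<exists>V. open V \<and> U = f -` V)"
  by (simp add: functional_topology_def openin_pullback_topology)

lemma functional_topology_vector_topology:
  assumes "Vector_Spaces.linear smul (*) f"
  shows "functional_topology f \<in> vector_topologies smul"
proof -
  interpret f: Vector_Spaces.linear smul "(*)" f by fact
  let ?T = "functional_topology f"
  have f: "continuous_map ?T euclidean f"
    using continuous_map_pullback[of euclidean euclidean id UNIV f]
    by (simp add: functional_topology_def)
  have plus: "continuous_map euclidean euclidean (\<lambda>(a, b). a + b :: 'k)"
    and times: "continuous_map euclidean euclidean (\<lambda>(a, b). a * b :: 'k)"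
    by (auto simp: case_prod_unfold intro!: continuous_intros)
  have "continuous_map (prod_topology ?T ?T) euclidean ((\<lambda>(a, b). a + b) \<circ> (\<lambda>p. (f (fst p), f (snd p))))"
    by (intro continuous_map_compose[OF _ plus] continuous_map_compose[OF _ f, unfolded comp_def]
        continuous_map_fst continuous_map_snd continuous_map_pairedI[of _ euclidean _ euclidean, simplified])
  moreover have "continuous_map (prod_topology euclidean ?T) euclidean ((\<lambda>(a, b). a * b) \<circ> (\<lambda>p. (fst p, f (snd p))))"
    by (intro continuous_map_compose[OF _ times] continuous_map_compose[OF _ f, unfolded comp_def]
        continuous_map_fst continuous_map_snd continuous_map_pairedI[of _ euclidean _ euclidean, simplified])
  ultimately show ?thesis
    unfolding vector_topologies_def functional_topology_def
    by (auto simp: topspace_pullback_topology f.add f.scale comp_def case_prod_unfold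
        intro!: continuous_map_pullback')
qed

text \<open>Points of the field are separated by open sets, so inseparability means equal values.\<close>

lemma functional_topology_inseparable_iff:
  "(\<forall>U. openin (functional_topology f) U \<longrightarrow> (x \<in> U \<longleftrightarrow> y \<in> U)) \<longleftrightarrow> f x = f y"
proof
  assume *: "\<forall>U. openin (functional_topology f) U \<longrightarrow> (x \<in> U \<longleftrightarrow> y \<in> U)"
  show "f x = f y"
  proof (rule ccontr)
    assume "f x \<noteq> f y"
    then obtain V where "open V" "f x \<in> V" "f y \<notin> V" using t1_space by blast
    then show False using * openin_functional_topology by (metis vimage_eq)
  qed
qed (auto simp: openin_functional_topology)

text \<open>The image of the topology of \<open>f\<close> is a vector topology. Its inseparability classes are
  the images of the cosets of the kernel, and they are cosets of a subspace.\<close>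

lemma image_kernel:
  assumes \<phi>: "bij \<phi>" "\<phi> 0 = 0"
    and pres: "\<And>T. T \<in> vector_topologies smul \<Longrightarrow> push \<phi> T \<in> vector_topologies smul"
    and f: "Vector_Spaces.linear smul (*) f"
  shows "subspace (\<phi> ` {x. f x = 0})"
    and "\<phi> x - \<phi> y \<in> \<phi> ` {x. f x = 0} \<longleftrightarrow> f x = f y"
proof -
  interpret f: Vector_Spaces.linear smul "(*)" f by fact
  let ?T = "push \<phi> (functional_topology f)"
  have T: "?T \<in> vector_topologies smul"
    using pres functional_topology_vector_topology[OF f] .
  have *: "\<phi> x - \<phi> y \<in> zero_closure ?T \<longleftrightarrow> f x = f y" for x y
  proof -
    have "(\<forall>U. openin ?T U \<longrightarrow> (\<phi> x \<in> U \<longleftrightarrow> \<phi> y \<in> U)) \<longleftrightarrow>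
        (\<forall>U. openin (functional_topology f) U \<longrightarrow> (x \<in> U \<longleftrightarrow> y \<in> U))" (is "?l \<longleftrightarrow> ?r")
    proof
      assume l: ?l
      show ?r
      proof (intro allI impI)
        fix U assume "openin (functional_topology f) U"
        moreover have "U = \<phi> -` \<phi> ` U" using \<phi>(1) by (simp add: bij_is_inj inj_vimage_image_eq)
        ultimately have "\<phi> x \<in> \<phi> ` U \<longleftrightarrow> \<phi> y \<in> \<phi> ` U" using l by (simp add: openin_push)
        then show "x \<in> U \<longleftrightarrow> y \<in> U" using \<phi>(1) by (simp add: bij_is_inj inj_image_mem_iff)
      qed
    qed (auto simp: openin_push)
    then show ?thesis
      using diff_mem_zero_closure_iff[OF T] functional_topology_inseparable_iff by simp
  qed
  have eq: "\<phi> ` {x. f x = 0} = zero_closure ?T"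
  proof (rule Set.set_eqI)
    fix z
    obtain x where z: "z = \<phi> x" using \<phi>(1) by (meson bij_pointE)
    have "z \<in> zero_closure ?T \<longleftrightarrow> f x = 0" using *[of x 0] by (simp add: z \<phi>(2) f.zero)
    then show "z \<in> \<phi> ` {x. f x = 0} \<longleftrightarrow> z \<in> zero_closure ?T"
      unfolding z by (simp add: inj_image_mem_iff[OF bij_is_inj[OF \<phi>(1)]])
  qed
  show "subspace (\<phi> ` {x. f x = 0})" unfolding eq by (rule subspace_zero_closure[OF T])
  show "\<phi> x - \<phi> y \<in> \<phi> ` {x. f x = 0} \<longleftrightarrow> f x = f y" unfolding eq by (rule *)
qed

lemma image_subspace:
  assumes \<phi>: "bij \<phi>" "\<phi> 0 = 0"
    and pres: "\<And>T. T \<in> vector_topologies smul \<Longrightarrow> push \<phi> T \<in> vector_topologies smul"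
    and W: "subspace W"
  shows "subspace (\<phi> ` W)" and "x - y \<in> W \<Longrightarrow> \<phi> x - \<phi> y \<in> \<phi> ` W"
proof -
  let ?F = "{f. Vector_Spaces.linear smul (*) f \<and> (\<forall>w\<in>W. f w = 0)}"
  \<comment> \<open>Writing \<open>W\<close> as an intersection of kernels reduces everything to hyperplanes.\<close>
  have W_eq: "w \<in> W \<longleftrightarrow> (\<forall>f\<in>?F. f w = 0)" for w
  proof (cases "w \<in> W")
    case False
    then obtain f where f: "Vector_Spaces.linear smul (*) f" "\<And>w. w \<in> W \<Longrightarrow> f w = 0" and fw: "f w \<noteq> 0"
      using separating_functional[OF W False] by blast
    have "f \<in> ?F" using f by blast
    then show ?thesis using False fw by blast
  qed simp
  have inj: "\<phi> z \<in> \<phi> ` A \<longleftrightarrow> z \<in> A" for z A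
    using \<phi>(1) by (simp add: bij_is_inj inj_image_mem_iff)
  have eq: "\<phi> ` W = \<Inter>((\<lambda>f. \<phi> ` {x. f x = 0}) ` ?F)"
  proof (rule Set.set_eqI)
    fix z
    obtain x where z: "z = \<phi> x" using \<phi>(1) by (meson bij_pointE)
    have "z \<in> \<phi> ` W \<longleftrightarrow> x \<in> W" unfolding z by (rule inj)
    also have "\<dots> \<longleftrightarrow> (\<forall>f\<in>?F. f x = 0)" by (rule W_eq)
    also have "\<dots> \<longleftrightarrow> z \<in> \<Inter>((\<lambda>f. \<phi> ` {x. f x = 0}) ` ?F)"
      unfolding z by (simp only: INT_iff inj mem_Collect_eq)
    finally show "z \<in> \<phi> ` W \<longleftrightarrow> z \<in> \<Inter>((\<lambda>f. \<phi> ` {x. f x = 0}) ` ?F)" .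
  qed
  show "subspace (\<phi> ` W)"
    unfolding eq by (rule subspace_Inter) (use image_kernel(1)[OF \<phi> pres] in auto)
  assume xy: "x - y \<in> W"
  have "\<phi> x - \<phi> y \<in> \<phi> ` {x. f x = 0}" if f: "f \<in> ?F" for f
  proof -
    interpret f: Vector_Spaces.linear smul "(*)" f using f by simp
    have "f (x - y) = 0" using f xy by blast
    then have "f x = f y" by (simp add: f.diff)
    then show ?thesis using image_kernel(2)[OF \<phi> pres] f by blast
  qed
  then show "\<phi> x - \<phi> y \<in> \<phi> ` W" unfolding eq by blast
qed

text \<open>Choose a functional \<open>f\<close> and a vector \<open>e\<close> with \<open>f e = 1\<close>. In the
  image of the topology of \<open>f\<close>, the map \<open>\<alpha> \<mapsto> \<alpha> \<phi>(e)\<close> is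
  continuous, and it pulls \<open>\<phi> ` f -` U\<close> back to \<open>\<psi> ` U\<close>.\<close>

lemma open_image_field_automorphism:
  assumes \<phi>: "bij \<phi>" and x: "(x :: 'v) \<noteq> 0"
    and pres: "\<And>T. T \<in> vector_topologies smul \<Longrightarrow> push \<phi> T \<in> vector_topologies smul"
    and \<psi>: "field_automorphism \<psi>" "semilinear smul \<psi> \<phi>"
    and U: "open U"
  shows "open (\<psi> ` U)"
proof -
  have b: "bij \<psi>" using \<psi>(1) by (simp add: field_automorphism_def)
  obtain f where f: "Vector_Spaces.linear smul (*) f" "f x \<noteq> 0"
    using separating_functional[of "{0}" x] x subspace_single_0 by auto
  interpret f: Vector_Spaces.linear smul "(*)" f by fact
  define e where "e = smul (inverse (f x)) x"
  have fe: "f e = 1" using f(2) by (simp add: e_def f.scale)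
  let ?T = "push \<phi> (functional_topology f)"
  have T: "?T \<in> vector_topologies smul"
    using pres functional_topology_vector_topology[OF f(1)] .
  have "openin ?T (\<phi> ` f -` U)"
    using U \<phi> by (auto simp: openin_push openin_functional_topology bij_is_inj inj_vimage_image_eq)
  then have "open ((\<lambda>\<alpha>. smul \<alpha> (\<phi> e)) -` \<phi> ` f -` U)" by (rule open_scalar_vimage[OF T])
  moreover have "(\<lambda>\<alpha>. smul \<alpha> (\<phi> e)) -` \<phi> ` f -` U = \<psi> ` U"
  proof (rule Set.set_eqI)
    fix \<alpha>
    obtain \<beta> where \<beta>: "\<alpha> = \<psi> \<beta>" using b by (meson bij_pointE)
    have "smul \<alpha> (\<phi> e) = \<phi> (smul \<beta> e)" using \<psi>(2) \<beta> by (simp add: semilinear_def)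
    then have "smul \<alpha> (\<phi> e) \<in> \<phi> ` f -` U \<longleftrightarrow> \<beta> \<in> U"
      using \<phi> by (simp add: bij_is_inj inj_image_mem_iff f.scale fe)
    also have "\<dots> \<longleftrightarrow> \<alpha> \<in> \<psi> ` U" using b \<beta> by (simp add: bij_is_inj inj_image_mem_iff)
    finally show "\<alpha> \<in> (\<lambda>\<alpha>. smul \<alpha> (\<phi> e)) -` \<phi> ` f -` U \<longleftrightarrow> \<alpha> \<in> \<psi> ` U" by simp
  qed
  ultimately show ?thesis by simp
qed

lemma push_inv_image_vector_topologies:
  assumes f: "bij f" and V: "push f ` vector_topologies smul = vector_topologies smul"
  shows "push (inv_into UNIV f) ` vector_topologies smul = vector_topologies smul"
proof -
  have "push (inv_into UNIV f) ` push f ` vector_topologies smul = vector_topologies smul"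
    using f by (simp add: image_image push_push push_id bij_is_inj)
  then show ?thesis unfolding V .
qed

lemma GammaL_h_if_preserves_vector_topologies:
  assumes dim2: "\<And>x. \<exists>z. z \<notin> span {x}"
    and \<phi>: "bij \<phi>" "\<phi> 0 = 0"
    and V: "push \<phi> ` vector_topologies smul = vector_topologies smul"
  shows "\<phi> \<in> GammaL_h smul"
proof -
  let ?\<phi>' = "inv_into UNIV \<phi>"
  have \<phi>': "bij ?\<phi>'" "?\<phi>' 0 = 0"
    using \<phi> by (simp_all add: bij_imp_bij_inv inv_f_eq bij_is_inj)
  have pres: "push \<phi> T \<in> vector_topologies smul" "push ?\<phi>' T \<in> vector_topologies smul"
    if "T \<in> vector_topologies smul" for T
    using that V push_inv_image_vector_topologies[OF \<phi>(1) V] by blast+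
  obtain \<psi> where \<psi>: "field_automorphism \<psi>" "semilinear smul \<psi> \<phi>"
  proof (rule parallel_preserving_imp_semilinear[OF \<phi>])
    show "subspace (\<phi> -` W)" if "subspace W" for W
      using image_subspace(1)[OF \<phi>' pres(2) that] \<phi>(1) by (simp add: bij_vimage_eq_inv_image)
  qed (use image_subspace[OF \<phi> pres(1)] dim2 in auto)
  obtain x where "x \<notin> span {0}" using dim2 by blast
  then have x: "x \<noteq> 0" using span_zero by blast
  have b: "bij \<psi>" using \<psi>(1) by (simp add: field_automorphism_def)
  have surj: "\<phi> (?\<phi>' y) = y" "\<psi> (inv_into UNIV \<psi> a) = a" for y a
    using \<phi>(1) b by (simp_all add: bij_is_surj surj_f_inv_f)
  have inv_eq: "?\<phi>' (\<phi> y) = y" "inv_into UNIV \<psi> (\<psi> a) = a" for y a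
    using \<phi>(1) b by (simp_all add: bij_is_inj)
  have "field_automorphism (inv_into UNIV \<psi>)"
    using \<psi>(1) b unfolding field_automorphism_def
    by (auto intro: bij_imp_bij_inv) (metis inv_eq(2) surj(2))+
  moreover have "semilinear smul (inv_into UNIV \<psi>) ?\<phi>'"
    using \<psi>(2) unfolding semilinear_def by (metis inv_eq(1) surj)
  ultimately have "open (inv_into UNIV \<psi> ` U)" if "open U" for U
    using open_image_field_automorphism[OF \<phi>'(1) x pres(2)] that by blast
  moreover have "open (\<psi> ` U)" if "open U" for U
    using open_image_field_automorphism[OF \<phi>(1) x pres(1) \<psi> that] .
  ultimately have "homeomorphic_map euclidean euclidean \<psi>"
    using b by (intro bijective_open_imp_homeomorphic_map)
      (simp_all add: open_map_def continuous_on_open_vimage bij_vimage_eq_inv_image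
        bij_is_inj bij_is_surj)
  then show ?thesis using \<phi>(1) \<psi> by (auto simp: GammaL_h_def)
qed

text \<open>The operations of the image topology are obtained by conjugating those of \<open>T\<close> with
  \<open>\<phi>\<close> on vectors and the homeomorphism \<open>\<psi>\<close> on scalars.\<close>

lemma push_GammaL_h_mem:
  assumes \<phi>: "\<phi> \<in> GammaL_h smul" and T: "T \<in> vector_topologies smul"
  shows "push \<phi> T \<in> vector_topologies smul"
proof -
  obtain \<psi> where \<psi>: "homeomorphic_map euclidean euclidean \<psi>" "semilinear smul \<psi> \<phi>" and b: "bij \<phi>"
    using \<phi> by (auto simp: GammaL_h_def)
  obtain \<psi>' where \<psi>': "homeomorphic_maps euclidean euclidean \<psi> \<psi>'"
    using \<psi>(1) homeomorphic_map_maps by blast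
  let ?P = "push \<phi> T" and ?\<phi>' = "inv_into UNIV \<phi>"
  have m: "T \<in> topologies" "?P \<in> topologies" using T vector_topology_mem push_mem by blast+
  note c = continuous_map_push[OF m(1), of \<phi>] continuous_map_push_inv[OF b m(1)]
  have s: "\<phi> (?\<phi>' x) = x" "\<psi> (\<psi>' a) = a" for x a
    using b \<psi>' by (simp_all add: bij_is_surj surj_f_inv_f homeomorphic_maps_def)
  have vt: "continuous_map (prod_topology T T) T (\<lambda>(x, y). x + y)"
    "continuous_map (prod_topology euclidean T) T (\<lambda>(\<alpha>, x). smul \<alpha> x)"
    using T by (simp_all add: vector_topologies_def)
  have "continuous_map (prod_topology ?P ?P) ?P
      (\<phi> \<circ> ((\<lambda>(x, y). x + y) \<circ> (\<lambda>p. (?\<phi>' (fst p), ?\<phi>' (snd p)))))"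
    by (intro continuous_map_compose[OF _ c(1)] continuous_map_compose[OF _ vt(1)]
        continuous_map_pairedI continuous_map_compose[OF _ c(2), unfolded comp_def]
        continuous_map_fst continuous_map_snd)
  moreover have "\<phi> \<circ> ((\<lambda>(x, y). x + y) \<circ> (\<lambda>p. (?\<phi>' (fst p), ?\<phi>' (snd p)))) = (\<lambda>(x, y). x + y)"
    using \<psi>(2) s by (auto simp: semilinear_def fun_eq_iff)
  moreover have "continuous_map (prod_topology euclidean ?P) ?P
      (\<phi> \<circ> ((\<lambda>(\<alpha>, x). smul \<alpha> x) \<circ> (\<lambda>p. (\<psi>' (fst p), ?\<phi>' (snd p)))))"
  proof -
    have "continuous_map euclidean euclidean \<psi>'" using \<psi>' by (simp add: homeomorphic_maps_def)
    then show ?thesis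
      by (intro continuous_map_compose[OF _ c(1)] continuous_map_compose[OF _ vt(2)]
          continuous_map_pairedI continuous_map_compose[OF _ c(2), unfolded comp_def]
          continuous_map_compose[OF continuous_map_fst, unfolded comp_def] continuous_map_snd)
  qed
  moreover have "\<phi> \<circ> ((\<lambda>(\<alpha>, x). smul \<alpha> x) \<circ> (\<lambda>p. (\<psi>' (fst p), ?\<phi>' (snd p)))) = (\<lambda>(\<alpha>, x). smul \<alpha> x)"
    using \<psi>(2) s by (auto simp: semilinear_def fun_eq_iff)
  ultimately show ?thesis using m(2) by (simp add: vector_topologies_def topologies_def)
qed

end

section \<open>The automorphism group\<close>

context topological_field_vector_space
begin

text \<open>A finite space has a least open neighbourhood \<open>N\<close> of \<open>0\<close>, and \<open>N = - N\<close>
  by minimality. If a translate \<open>y + N\<close> met an open set \<open>U\<close> in \<open>z\<close>,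
  then \<open>y\<close>, lying in \<open>z + N\<close>, would belong to \<open>U\<close>.\<close>

lemma closed_set_topology_vector_topology:
  assumes fin: "finite (UNIV :: 'v set)" and T: "T \<in> vector_topologies smul"
  shows "closed_set_topology T = T"
proof -
  have m: "T \<in> topologies" using vector_topology_mem[OF T] .
  define N where "N = \<Inter>{U. openin T U \<and> 0 \<in> U}"
  have N: "openin T N"
    unfolding N_def using fin openin_UNIV[OF m]
    by (intro openin_Inter) (auto intro: finite_subset[OF subset_UNIV] simp: Finite_Set.finite_set)
  have N0: "0 \<in> N" by (auto simp: N_def)
  have least: "n \<in> U" if "openin T U" "0 \<in> U" "n \<in> N" for n U using that by (auto simp: N_def)
  have compl: "openin T (- U)" if U: "openin T U" for U
  proof (subst openin_subopen, intro ballI)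
    fix y assume y: "y \<in> - U"
    let ?V = "(\<lambda>x. - y + x) -` N"
    have "?V \<subseteq> - U"
    proof
      fix z assume z: "z \<in> ?V"
      have "z \<notin> U"
      proof
        assume "z \<in> U"
        \<comment> \<open>The set of all \<open>x\<close> with \<open>z - x \<in> U\<close> is an open neighbourhood of \<open>0\<close>, so it contains \<open>z - y\<close>.\<close>
        have "openin T (smul (- 1) -` ((\<lambda>x. z + x) -` U))"
          using openin_scaling_vimage[OF T openin_translation_vimage[OF T U]] .
        then have "- y + z \<in> smul (- 1) -` ((\<lambda>x. z + x) -` U)"
          by (rule least) (use z \<open>z \<in> U\<close> in auto)
        then show False using y by simp
      qed
      then show "z \<in> - U" by simp
    qed
    moreover have "openin T ?V" using openin_translation_vimage[OF T N] .
    moreover have "y \<in> ?V" using N0 by simp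
    ultimately show "\<exists>V. openin T V \<and> y \<in> V \<and> V \<subseteq> - U" by blast
  qed
  then show ?thesis
    unfolding topology_eq openin_closed_set_topology[OF fin m] by (metis double_complement)
qed

definition affine_map :: "'v \<times> ('v \<Rightarrow> 'v) \<Rightarrow> 'v \<Rightarrow> 'v" where
  "affine_map p = (\<lambda>y. fst p + snd p y)"

lemma affine_map_mult:
  assumes "p \<in> carrier (semidirect_GammaL_h smul)" "q \<in> carrier (semidirect_GammaL_h smul)"
  shows "affine_map (p \<otimes>\<^bsub>semidirect_GammaL_h smul\<^esub> q) = affine_map p \<circ> affine_map q"
  using assms
  by (auto simp: semidirect_GammaL_h_def affine_map_def GammaL_h_def semilinear_def add.assoc)

lemma bij_affine_map:
  assumes "p \<in> carrier (semidirect_GammaL_h smul)"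
  shows "bij (affine_map p)"
proof -
  have "bij (snd p)" using assms by (auto simp: semidirect_GammaL_h_def GammaL_h_def)
  moreover have "bij ((+) (fst p))" by (rule bij_plus)
  moreover have "affine_map p = (+) (fst p) \<circ> snd p" by (auto simp: affine_map_def)
  ultimately show ?thesis by (simp only: bij_comp)
qed

lemma inj_affine_map: "inj_on affine_map (carrier (semidirect_GammaL_h smul))"
proof (rule inj_onI)
  fix p q assume p: "p \<in> carrier (semidirect_GammaL_h smul)" and q: "q \<in> carrier (semidirect_GammaL_h smul)"
    and eq: "affine_map p = affine_map q"
  have z: "snd r 0 = 0" if "r \<in> carrier (semidirect_GammaL_h smul)" for r
  proof -
    have "snd r (x + y) = snd r x + snd r y" for x y
      using that by (auto simp: semidirect_GammaL_h_def GammaL_h_def semilinear_def)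
    from this[of 0 0] show ?thesis by simp
  qed
  have "fst p = fst q" using fun_cong[OF eq, of 0] z[OF p] z[OF q] by (simp add: affine_map_def)
  moreover from this have "snd p = snd q"
    using fun_cong[OF eq] by (intro ext) (simp add: affine_map_def)
  ultimately show "p = q" by (rule prod_eqI)
qed

lemma push_affine_map_mem:
  assumes "p \<in> carrier (semidirect_GammaL_h smul)" "T \<in> vector_topologies smul"
  shows "push (affine_map p) T \<in> vector_topologies smul"
proof -
  have "snd p \<in> GammaL_h smul" using assms(1) by (auto simp: semidirect_GammaL_h_def)
  then have "push (snd p) T \<in> vector_topologies smul" using assms(2) by (rule push_GammaL_h_mem)
  moreover have "push (affine_map p) T = push (\<lambda>x. fst p + x) (push (snd p) T)"
    by (simp add: push_push comp_def affine_map_def)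
  ultimately show ?thesis by (simp add: push_translation)
qed

lemma push_affine_map_image:
  assumes p: "p \<in> carrier (semidirect_GammaL_h smul)"
  shows "push (affine_map p) ` vector_topologies smul = vector_topologies smul"
proof
  interpret G: group "semidirect_GammaL_h smul" by (rule group_semidirect_GammaL_h)
  let ?q = "inv\<^bsub>semidirect_GammaL_h smul\<^esub> p"
  show "vector_topologies smul \<subseteq> push (affine_map p) ` vector_topologies smul"
  proof
    fix T assume T: "T \<in> vector_topologies smul"
    have "affine_map p \<circ> affine_map ?q = affine_map \<one>\<^bsub>semidirect_GammaL_h smul\<^esub>"
      using p by (simp flip: affine_map_mult)
    also have "\<dots> = id" by (auto simp: affine_map_def semidirect_GammaL_h_def)
    finally have "T = push (affine_map p) (push (affine_map ?q) T)" by (simp add: push_push push_id)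
    then show "T \<in> push (affine_map p) ` vector_topologies smul"
      using push_affine_map_mem[OF G.inv_closed[OF p] T] by blast
  qed
qed (use push_affine_map_mem[OF p] in auto)

lemma affine_if_preserves_vector_topologies:
  assumes dim2: "\<And>x. \<exists>z. z \<notin> span {x}"
    and f: "bij f" and V: "push f ` vector_topologies smul = vector_topologies smul"
  obtains p where "p \<in> carrier (semidirect_GammaL_h smul)" "f = affine_map p"
proof -
  define \<phi> where "\<phi> = (\<lambda>x. - f 0 + f x)"
  have \<phi>: "\<phi> = (+) (- f 0) \<circ> f" by (auto simp: \<phi>_def)
  have "push \<phi> T = push f T" if T: "T \<in> vector_topologies smul" for T
  proof -
    have "push f T \<in> vector_topologies smul" using T V by blast
    then show ?thesis unfolding \<phi> push_push[symmetric] by (rule push_translation)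
  qed
  then have "push \<phi> ` vector_topologies smul = vector_topologies smul"
    using V by (metis (no_types, lifting) image_cong)
  moreover have "bij \<phi>" unfolding \<phi> using f by (intro bij_comp bij_plus)
  moreover have "\<phi> 0 = 0" by (simp add: \<phi>_def)
  ultimately have "\<phi> \<in> GammaL_h smul"
    using GammaL_h_if_preserves_vector_topologies[OF dim2] by blast
  then show ?thesis
    using that[of "(f 0, \<phi>)"] by (simp add: semidirect_GammaL_h_def affine_map_def \<phi>_def)
qed

lemma vector_topologies_subset: "vector_topologies smul \<subseteq> topologies"
  using vector_topology_mem by blast

lemma carrier_Aut_Sigma_tau:
  "carrier (Aut_Sigma_tau smul) = {\<Phi> \<in> lattice_automorphisms topology_lattice.
     \<Phi> ` vector_topologies smul = vector_topologies smul}"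
  by (simp add: Aut_Sigma_tau_def)

lemma mult_Aut_Sigma_tau:
  assumes "\<Phi> \<in> carrier (Aut_Sigma_tau smul)" "\<Psi> \<in> carrier (Aut_Sigma_tau smul)"
  shows "\<Phi> \<otimes>\<^bsub>Aut_Sigma_tau smul\<^esub> \<Psi> = compose topologies \<Phi> \<Psi>"
  using assms unfolding carrier_Aut_Sigma_tau
  by (simp add: Aut_Sigma_tau_def BijGroup_def lattice_automorphisms_def carrier_topology_lattice)

lemma push_affine_map_Aut:
  assumes "p \<in> carrier (semidirect_GammaL_h smul)"
  shows "restrict (push (affine_map p)) topologies \<in> carrier (Aut_Sigma_tau smul)"
proof -
  have "restrict (push (affine_map p)) topologies ` vector_topologies smul
      = push (affine_map p) ` vector_topologies smul"
    using vector_topologies_subset by (intro image_cong) auto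
  then show ?thesis
    using push_affine_map_image[OF assms] restrict_push_lattice_automorphism[OF bij_affine_map[OF assms]]
    by (simp add: carrier_Aut_Sigma_tau)
qed

lemma push_closed_affine_map_Aut:
  assumes "finite (UNIV :: 'v set)" "p \<in> carrier (semidirect_GammaL_h smul)"
  shows "(\<lambda>T\<in>topologies. push (affine_map p) (closed_set_topology T)) \<in> carrier (Aut_Sigma_tau smul)"
proof -
  have "(\<lambda>T\<in>topologies. push (affine_map p) (closed_set_topology T)) ` vector_topologies smul
      = push (affine_map p) ` vector_topologies smul"
    using vector_topologies_subset closed_set_topology_vector_topology[OF assms(1)]
    by (intro image_cong) auto
  then show ?thesis
    using push_affine_map_image[OF assms(2)]
      restrict_push_closed_lattice_automorphism[OF assms(1) bij_affine_map[OF assms(2)]]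
    by (simp add: carrier_Aut_Sigma_tau)
qed

lemma Aut_Sigma_tau_cases:
  assumes dim2: "\<And>x. \<exists>z. z \<notin> span {x}"
    and \<Phi>: "\<Phi> \<in> carrier (Aut_Sigma_tau smul)"
  obtains p where "p \<in> carrier (semidirect_GammaL_h smul)" "\<Phi> = restrict (push (affine_map p)) topologies"
  | p where "finite (UNIV :: 'v set)" "p \<in> carrier (semidirect_GammaL_h smul)"
      "\<Phi> = (\<lambda>T\<in>topologies. push (affine_map p) (closed_set_topology T))"
proof -
  have lat: "\<Phi> \<in> lattice_automorphisms topology_lattice"
    and V: "\<Phi> ` vector_topologies smul = vector_topologies smul"
    using \<Phi> by (simp_all add: carrier_Aut_Sigma_tau)
  have ext: "\<Phi> \<in> extensional topologies"
    using lat by (simp add: lattice_automorphisms_topology_lattice Bij_def)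
  show ?thesis
    using lat four_elements[OF dim2]
  proof (cases rule: lattice_automorphism_cases)
    case (1 f)
    have "push f ` vector_topologies smul = \<Phi> ` vector_topologies smul"
      using 1(2) vector_topologies_subset by (intro image_cong) auto
    then obtain p where "p \<in> carrier (semidirect_GammaL_h smul)" "f = affine_map p"
      using affine_if_preserves_vector_topologies[OF dim2 1(1)] V by metis
    moreover have "\<Phi> = restrict (push f) topologies"
      by (rule extensionalityI[OF ext restrict_extensional]) (simp add: 1(2))
    ultimately show ?thesis using that(1) by blast
  next
    case (2 f)
    have "push f ` vector_topologies smul = \<Phi> ` vector_topologies smul"
      using 2(3) vector_topologies_subset closed_set_topology_vector_topology[OF 2(1)]
      by (intro image_cong) auto
    then obtain p where "p \<in> carrier (semidirect_GammaL_h smul)" "f = affine_map p"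
      using affine_if_preserves_vector_topologies[OF dim2 2(2)] V by metis
    moreover have "\<Phi> = (\<lambda>T\<in>topologies. push f (closed_set_topology T))"
      by (rule extensionalityI[OF ext restrict_extensional]) (simp add: 2(3))
    ultimately show ?thesis using that(2) 2(1) by blast
  qed
qed

end

lemma vimage_singleton_bij: "bij f \<Longrightarrow> f -` {f x} = {x}"
  by (auto dest: injD[OF bij_is_inj])

text \<open>The topology with \<open>{x}\<close> as its only nontrivial open set reveals the image of
  \<open>x\<close>.\<close>

lemma push_eq_imp_eq:
  fixes f g :: "'a \<Rightarrow> 'b"
  assumes "bij f" "bij g" and two: "\<And>a :: 'a. \<exists>b. b \<noteq> a"
    and eq: "\<And>T. T \<in> topologies \<Longrightarrow> push f T = push g T"
  shows "f = g"
proof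
  fix x
  have "openin (push f (one_set_topology {x})) {f x}"
    using assms(1) by (simp add: openin_push openin_one_set_topology vimage_singleton_bij)
  then have "g -` {f x} \<in> {{}, {x}, UNIV}"
    by (simp add: eq[OF one_set_topology_mem] openin_push openin_one_set_topology)
  moreover obtain y where "f x = g y" using assms(2) by (rule bij_pointE)
  then have y: "g -` {f x} = {y}" using vimage_singleton_bij[OF assms(2)] by metis
  moreover have "{y} \<noteq> UNIV" using two[of y] by blast
  ultimately have "g -` {f x} = {x}" by auto
  then have "x \<in> g -` {f x}" by blast
  then show "f x = g x" by simp
qed

text \<open>Of the two images of the topology generated by a point, one has a point and the other the
  complement of a point as its only nontrivial open set.\<close>

lemma push_neq_push_closed:
  fixes f g :: "'a \<Rightarrow> 'b"
  assumes fin: "finite (UNIV :: 'a set)" and "bij f" "bij g"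
    and three: "\<And>a b :: 'a. \<exists>c. c \<noteq> a \<and> c \<noteq> b"
  obtains T where "T \<in> topologies" "push f T \<noteq> push g (closed_set_topology T)"
proof -
  fix x :: 'a
  let ?T = "one_set_topology {x}"
  have "push f ?T \<noteq> push g (closed_set_topology ?T)"
  proof
    assume *: "push f ?T = push g (closed_set_topology ?T)"
    have "openin (push f ?T) {f x}"
      using assms(2) by (simp add: openin_push openin_one_set_topology vimage_singleton_bij)
    then have "- g -` {f x} \<in> {{}, {x}, UNIV}"
      by (simp add: * openin_push openin_closed_set_topology[OF fin one_set_topology_mem]
          openin_one_set_topology)
    moreover obtain y where "f x = g y" using assms(3) by (rule bij_pointE)
    then have "g -` {f x} = {y}" using vimage_singleton_bij[OF assms(3)] by metis
    ultimately have y: "- {y} \<in> {{}, {x}, UNIV}" by simp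
    obtain b where b: "b \<noteq> x" "b \<noteq> y" using three by blast
    then have "b \<in> - {y}" "b \<notin> {x}" "y \<notin> - {y}" by simp_all
    then have "- {y} \<noteq> {}" "- {y} \<noteq> {x}" "- {y} \<noteq> UNIV" by blast+
    then show False using y by simp
  qed
  then show ?thesis using that one_set_topology_mem by blast
qed

theorem theoremB:
  fixes smul :: "'k::topological_field \<Rightarrow> 'v::ab_group_add \<Rightarrow> 'v"
  assumes "vector_space smul"
    and "vdim smul \<ge> 2"
  shows "(finite (UNIV :: 'v set) \<longrightarrow>
            Aut_Sigma_tau smul \<cong> semidirect_GammaL_h smul \<times>\<times> integer_mod_group 2) \<and>
         (infinite (UNIV :: 'v set) \<longrightarrow>
            Aut_Sigma_tau smul \<cong> semidirect_GammaL_h smul)"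
proof -
  interpret topological_field_vector_space smul
    using assms(1) by (simp add: topological_field_vector_space_def)
  let ?S = "semidirect_GammaL_h smul" and ?A = "Aut_Sigma_tau smul"
  have dim2: "\<exists>z. z \<notin> span {x}" for x using notin_span_singleton_of_vdim[OF assms(2)] .
  note big = four_elements[OF dim2]
  interpret S: group ?S by (rule group_semidirect_GammaL_h)
  have inj: "p = q" if pq: "p \<in> carrier ?S" "q \<in> carrier ?S"
    and eq: "\<And>T. T \<in> topologies \<Longrightarrow> push (affine_map p) T = push (affine_map q) T" for p q
  proof -
    have "affine_map p = affine_map q"
      using push_eq_imp_eq[OF bij_affine_map[OF pq(1)] bij_affine_map[OF pq(2)] _ eq] big by blast
    then show ?thesis using inj_affine_map pq by (auto dest: inj_onD)
  qed
  show ?thesis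
  proof (intro conjI impI)
    assume inf: "infinite (UNIV :: 'v set)"
    have "(\<lambda>p. restrict (push (affine_map p)) topologies) \<in> iso ?S ?A"
      unfolding iso_iff
    proof (intro conjI)
      show "(\<lambda>p. restrict (push (affine_map p)) topologies) \<in> hom ?S ?A"
      proof (rule homI)
        fix p q assume pq: "p \<in> carrier ?S" "q \<in> carrier ?S"
        show "restrict (push (affine_map (p \<otimes>\<^bsub>?S\<^esub> q))) topologies =
            restrict (push (affine_map p)) topologies \<otimes>\<^bsub>?A\<^esub> restrict (push (affine_map q)) topologies"
          unfolding mult_Aut_Sigma_tau[OF pq[THEN push_affine_map_Aut]] affine_map_mult[OF pq]
          by (intro ext) (simp add: compose_def push_mem push_push)
      qed (rule push_affine_map_Aut)
      show "(\<lambda>p. restrict (push (affine_map p)) topologies) ` carrier ?S = carrier ?A"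
      proof
        show "carrier ?A \<subseteq> (\<lambda>p. restrict (push (affine_map p)) topologies) ` carrier ?S"
        proof
          fix \<Phi> assume "\<Phi> \<in> carrier ?A"
          with dim2 show "\<Phi> \<in> (\<lambda>p. restrict (push (affine_map p)) topologies) ` carrier ?S"
            by (cases rule: Aut_Sigma_tau_cases) (use inf in blast)+
        qed
      qed (use push_affine_map_Aut in blast)
      show "inj_on (\<lambda>p. restrict (push (affine_map p)) topologies) (carrier ?S)"
        by (intro inj_onI inj) (metis restrict_apply')+
    qed
    then show "?A \<cong> ?S" using S.iso_sym is_isoI by blast
  next
    assume fin: "finite (UNIV :: 'v set)"
    let ?D = "?S \<times>\<times> integer_mod_group 2"
    \<comment> \<open>the action of the factor of order two\<close>
    define c where "c k = (if k = 0 then (\<lambda>T :: 'v topology. T) else closed_set_topology)" for k :: int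
    define h where "h = (\<lambda>(p, k). \<lambda>T\<in>topologies. push (affine_map p) (c k T))"
    interpret D: group ?D by (intro DirProd_group S.group_axioms group_integer_mod_group)
    have D: "carrier ?D = carrier ?S \<times> {0, 1}"
      by (auto simp: carrier_integer_mod_group DirProd_def)
    have hA: "h (p, k) \<in> carrier ?A" if "p \<in> carrier ?S" for p k
      using push_affine_map_Aut[OF that] push_closed_affine_map_Aut[OF fin that]
      by (auto simp: h_def c_def)
    have cm: "c k T \<in> topologies" if "T \<in> topologies" for k T
      using that closed_set_topology_mem[OF fin] by (simp add: c_def)
    have "h \<in> iso ?D ?A"
      unfolding iso_iff
    proof (intro conjI)
      show "h \<in> hom ?D ?A"
      proof (rule homI)
        fix d e assume de: "d \<in> carrier ?D" "e \<in> carrier ?D"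
        obtain p k q l where d: "d = (p, k)" "p \<in> carrier ?S" "k \<in> {0, 1}"
          and e: "e = (q, l)" "q \<in> carrier ?S" "l \<in> {0, 1}" using de unfolding D by blast
        have *: "c ((k + l) mod 2) T = c k (c l T)" if "T \<in> topologies" for T
          using d(3) e(3) closed_set_topology_twice[OF fin that] by (auto simp: c_def)
        have **: "c k (push f T) = push f (c k T)" if "T \<in> topologies" for f and T :: "'v topology"
          using closed_set_topology_push[OF fin that] by (simp add: c_def)
        have "h (p \<otimes>\<^bsub>?S\<^esub> q, (k + l) mod 2) = compose topologies (h (p, k)) (h (q, l))"
          using d(2) e(2)
          by (intro ext) (simp add: h_def compose_def push_mem cm * ** affine_map_mult flip: push_push)
        then show "h (d \<otimes>\<^bsub>?D\<^esub> e) = h d \<otimes>\<^bsub>?A\<^esub> h e"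
          using d e mult_Aut_Sigma_tau[OF hA hA] by (simp add: DirProd_def)
      qed (use hA D in auto)
      show "h ` carrier ?D = carrier ?A"
      proof
        show "carrier ?A \<subseteq> h ` carrier ?D"
        proof
          fix \<Phi> assume "\<Phi> \<in> carrier ?A"
          with dim2 show "\<Phi> \<in> h ` carrier ?D"
          proof (cases rule: Aut_Sigma_tau_cases)
            case (1 p)
            then show ?thesis unfolding D by (intro image_eqI[of _ _ "(p, 0)"]) (auto simp: h_def c_def)
          next
            case (2 p)
            then show ?thesis unfolding D by (intro image_eqI[of _ _ "(p, 1)"]) (auto simp: h_def c_def)
          qed
        qed
      qed (use hA D in auto)
      show "inj_on h (carrier ?D)"
      proof (rule inj_onI)
        fix d e assume de: "d \<in> carrier ?D" "e \<in> carrier ?D" and eq: "h d = h e"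
        obtain p k q l where d: "d = (p, k)" "p \<in> carrier ?S" "k \<in> {0, 1}"
          and e: "e = (q, l)" "q \<in> carrier ?S" "l \<in> {0, 1}" using de unfolding D by blast
        have eq': "push (affine_map p) (c k T) = push (affine_map q) (c l T)" if "T \<in> topologies" for T
          using fun_cong[OF eq, of T] that by (simp add: d e h_def)
        have kl: "k = l"
        proof (rule ccontr)
          assume "k \<noteq> l"
          then consider "k = 0" "l = 1" | "k = 1" "l = 0" using d(3) e(3) by auto
          then obtain r s where rs: "r \<in> carrier ?S" "s \<in> carrier ?S"
            "\<And>T. T \<in> topologies \<Longrightarrow> push (affine_map r) T = push (affine_map s) (closed_set_topology T)"
          proof cases
            case 1
            then show ?thesis using that[OF d(2) e(2)] eq' by (simp add: c_def)
          next
            case 2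
            then show ?thesis using that[OF e(2) d(2)] eq'[symmetric] by (simp add: c_def)
          qed
          obtain T where "T \<in> topologies"
            "push (affine_map r) T \<noteq> push (affine_map s) (closed_set_topology T)"
            using push_neq_push_closed[OF fin bij_affine_map[OF rs(1)] bij_affine_map[OF rs(2)]] big
            by metis
          then show False using rs(3) by blast
        qed
        have cc: "c k (c k T) = T" if "T \<in> topologies" for T
          using closed_set_topology_twice[OF fin that] by (simp add: c_def)
        have "push (affine_map p) T = push (affine_map q) T" if "T \<in> topologies" for T
          using eq'[OF cm[OF that, of k]] unfolding kl[symmetric] cc[OF that] .
        then show "d = e" using inj d e kl by blast
      qed
    qed
    then show "?A \<cong> ?D" using D.iso_sym is_isoI by blast
  qed
qed

end
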